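(* Let ${\mathbf X}\in\mathbb{R}^{n\times p}$ be a deterministic design matrix, $\theta_0\in\mathbb{R}^p$, $S=\mathrm{supp}(\theta_0)$, $s_0=|S|$, and $Y={\mathbf X}\theta_0+W$ with $W\sim\mathsf{N}(0,\sigma^2 I_{n\times n})$. Let $\widehat\Sigma={\mathbf X}^{\sf T}{\mathbf X}/n$ with $\widehat\Sigma_{i,i}\le1$ for all $i\in[p]$. Let $T_0,v_0$ be as in the context. Assume: (i) $\sigma_{\min}(\widehat\Sigma_{T_0,T_0})\ge C_{\min}>0$; (ii) $\|\widehat\Sigma_{T_0^c,T_0}\widehat\Sigma_{T_0,T_0}^{-1}v_{0,T_0}\|_\infty\le1-\eta$ for some $\eta>0$; $\lambda=\frac{\sigma}{\eta}\sqrt{\frac{2c_1\log p}{n}}$ with a constant $c_1>1$; (iii) for some $c_2>0$, $|\theta_{0,i}|\ge c_2\lambda+\lambda|[\widehat\Sigma_{T_0,T_0}^{-1}v_{0,T_0}]_i|$ for all $i\in S$ and $|[\widehat\Sigma_{T_0,T_0}^{-1}v_{0,T_0}]_i|\ge c_2$ for all $i\in T_0\setminus S$; and $\eta\le c_2\sqrt{C_{\min}}$. Let $\widehat\theta^{\mathrm{GL}}$ and $\widehat S$ be the Gauss-Lasso estimator and selected model computed with this $\lambda$. Then for every $\mu>0$, $$\mathbb{P}\big(\|\widehat\theta^{\mathrm{GL}}-\theta_0\|_\infty\ge\mu\big)\le4p^{1-c_1}+2p\,e^{-nC_{\min}\mu^2/(2\sigma^2)},$$ and $$\mathbb{P}(\widehat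 S=S)\ge1-6p^{1-c_1/4}.$$
   Context: The Lasso estimator $\widehat\theta^n(\lambda)$ minimizes $\frac{1}{2n}\|Y-{\mathbf X}\theta\|_2^2+\lambda\|\theta\|_1$. Gauss-Lasso: let $T=\mathrm{supp}(\widehat\theta^n)$; set $\widehat\theta^{\mathrm{GL}}_T=({\mathbf X}_T^{\sf T}{\mathbf X}_T)^{-1}{\mathbf X}_T^{\sf T}Y$ and $\widehat\theta^{\mathrm{GL}}_{T^c}=0$ (${\mathbf X}_T$ = columns of ${\mathbf X}$ in $T$); with $\widehat\theta^{\mathrm{GL}}_{(s_0)}$ the $s_0$-th largest entry in modulus, $\widehat S=\{i\in[p]:|\widehat\theta^{\mathrm{GL}}_i|\ge|\widehat\theta^{\mathrm{GL}}_{(s_0)}|\}$. For $\xi>0$, $\widehat\theta^{\mathrm{ZN}}(\xi)$ is a minimizer of $\frac12\langle\theta-\theta_0,\widehat\Sigma(\theta-\theta_0)\rangle+\xi\|\theta\|_1$; there exist $\xi_0>0$, $T_0\subseteq[p]$, $v_0\in\{-1,0,+1\}^p$ with $\mathrm{sign}(\widehat\theta^{\mathrm{ZN}}(\xi))=v_0$ and $\mathrm{supp}(\widehat\theta^{\mathrm{ZN}}(\xi))=\mathrm{supp}(v_0)=T_0$ for all $\xi\in(0,\xi_0)$, and $T_0\supseteq S$, $v_{0,S}=\mathrm{sign}(\theta_{0,S})$. $\mathrm{sign}(u)_i=+1,0,-1$ according as $u_i>0,=0,<0$; $A_{I,J}$ submatrix, $A_{I,I}^{-1}=(A_{I,I})^{-1}$,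 $T^c=[p]\setminus T$, $\sigma_{\min}$ minimum singular value. *)

theory Defs
  imports "HOL-Probability.Probability"
begin

text \<open>Conventions: vectors in R^k are functions nat => real, only the
entries with index < k matter; matrices are nat => nat => real.
The design matrix X is n x p, indices i < n (rows) and j < p (columns).\<close>

definition Sigma_hat :: "nat \<Rightarrow> nat \<Rightarrow> (nat \<Rightarrow> nat \<Rightarrow> real) \<Rightarrow> nat \<Rightarrow> nat \<Rightarrow> real" where
  "Sigma_hat n p X i j = (\<Sum>k<n. X k i * X k j) / real n"

definition sub_inv :: "(nat \<Rightarrow> nat \<Rightarrow> real) \<Rightarrow> nat set \<Rightarrow> nat \<Rightarrow> nat \<Rightarrow> real" where
  "sub_inv A I = (THE B. (\<forall>i j. (i \<notin> I \<or> j \<notin> I) \<longrightarrow> B i j = 0) \<and>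
       (\<forall>i\<in>I. \<forall>j\<in>I. (\<Sum>k\<in>I. A i k * B k j) = (if i = j then 1 else 0)))"

definition sigma_min_sub :: "(nat \<Rightarrow> nat \<Rightarrow> real) \<Rightarrow> nat set \<Rightarrow> real" where
  "sigma_min_sub A I = Inf {sqrt (\<Sum>i\<in>I. (\<Sum>j\<in>I. A i j * x j)^2) | x.
       (\<Sum>j\<in>I. (x j)^2) = 1}"

definition sgn_vec :: "(nat \<Rightarrow> real) \<Rightarrow> nat \<Rightarrow> real" where
  "sgn_vec u i = sgn (u i)"

definition supp :: "nat \<Rightarrow> (nat \<Rightarrow> real) \<Rightarrow> nat set" where
  "supp p u = {i. i < p \<and> u i \<noteq> 0}"

definition lasso_obj :: "nat \<Rightarrow> nat \<Rightarrow> (nat \<Rightarrow> nat \<Rightarrow> real) \<Rightarrow> (nat \<Rightarrow> real) \<Rightarrow> real \<Rightarrow> (nat \<Rightarrow> real) \<Rightarrow> real" where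
  "lasso_obj n p X Y lam \<theta> =
     (1 / (2 * real n)) * (\<Sum>i<n. (Y i - (\<Sum>j<p. X i j * \<theta> j))^2) + lam * (\<Sum>j<p. \<bar>\<theta> j\<bar>)"

definition is_lasso :: "nat \<Rightarrow> nat \<Rightarrow> (nat \<Rightarrow> nat \<Rightarrow> real) \<Rightarrow> (nat \<Rightarrow> real) \<Rightarrow> real \<Rightarrow> (nat \<Rightarrow> real) \<Rightarrow> bool" where
  "is_lasso n p X Y lam \<theta> \<longleftrightarrow> (\<forall>j\<ge>p. \<theta> j = 0) \<and>
     (\<forall>\<theta>'. lasso_obj n p X Y lam \<theta> \<le> lasso_obj n p X Y lam \<theta>')"

definition gauss_lasso :: "nat \<Rightarrow> nat \<Rightarrow> (nat \<Rightarrow> nat \<Rightarrow> real) \<Rightarrow> (nat \<Rightarrow> real) \<Rightarrow> (nat \<Rightarrow> real) \<Rightarrow> nat \<Rightarrow> real" where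
  "gauss_lasso n p X Y \<theta>L i =
     (let T = supp p \<theta>L; G = (\<lambda>a b. \<Sum>k<n. X k a * X k b); Ginv = sub_inv G T in
      if i \<in> T then (\<Sum>j\<in>T. Ginv i j * (\<Sum>k<n. X k j * Y k)) else 0)"

definition kth_largest_abs :: "nat \<Rightarrow> nat \<Rightarrow> (nat \<Rightarrow> real) \<Rightarrow> real" where
  "kth_largest_abs p k u = rev (sort (map (\<lambda>i. \<bar>u i\<bar>) [0..<p])) ! (k - 1)"

text \<open>Selected model S_hat (for s0 = 0 the s0-th largest entry is undefined;
we set S_hat = {} in that degenerate case).\<close>
definition S_hat :: "nat \<Rightarrow> nat \<Rightarrow> (nat \<Rightarrow> real) \<Rightarrow> nat set" where
  "S_hat p s0 u = (if s0 = 0 then {} else {i. i < p \<and> \<bar>u i\<bar> \<ge> kth_largest_abs p s0 u})"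

definition zn_obj :: "nat \<Rightarrow> (nat \<Rightarrow> nat \<Rightarrow> real) \<Rightarrow> (nat \<Rightarrow> real) \<Rightarrow> real \<Rightarrow> (nat \<Rightarrow> real) \<Rightarrow> real" where
  "zn_obj p Sig \<theta>0 \<xi> \<theta> =
     (1/2) * (\<Sum>i<p. \<Sum>j<p. (\<theta> i - \<theta>0 i) * Sig i j * (\<theta> j - \<theta>0 j)) + \<xi> * (\<Sum>j<p. \<bar>\<theta> j\<bar>)"

definition is_zn :: "nat \<Rightarrow> (nat \<Rightarrow> nat \<Rightarrow> real) \<Rightarrow> (nat \<Rightarrow> real) \<Rightarrow> real \<Rightarrow> (nat \<Rightarrow> real) \<Rightarrow> bool" where
  "is_zn p Sig \<theta>0 \<xi> \<theta> \<longleftrightarrow> (\<forall>j\<ge>p. \<theta> j = 0) \<and> (\<forall>\<theta>'. zn_obj p Sig \<theta>0 \<xi> \<theta> \<le> zn_obj p Sig \<theta>0 \<xi> \<theta>')"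

definition noise :: "nat \<Rightarrow> real \<Rightarrow> (nat \<Rightarrow> real) measure" where
  "noise n \<sigma> = PiM {..<n} (\<lambda>_. density lborel (normal_density 0 \<sigma>))"

end

theory Submission
  imports Defs
begin

text \<open>With \<open>Z = \<Sigma>\<^sub>T\<^sub>T\<^sup>-\<^sup>1 X\<^sub>T\<^sup>t W / n\<close> for \<open>T = T0\<close>, the vector equal to
  \<open>\<theta>0 + Z - \<lambda> \<Sigma>\<^sub>T\<^sub>T\<^sup>-\<^sup>1 v0\<close> on \<open>T\<close> and to \<open>0\<close> elsewhere satisfies the optimality conditions of the
  Lasso, strictly off \<open>T\<close>, as soon as \<open>|Z\<^sub>i| < c2 \<lambda>\<close> on \<open>T\<close> and the noise projected orthogonally to
  the columns in \<open>T\<close> has correlation less than \<open>\<lambda> \<eta>\<close> with every column off \<open>T\<close>. The zero-noise problem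
  is a Lasso with response \<open>X \<theta>0\<close>, and its stationarity equations give the sign of \<open>\<Sigma>\<^sub>T\<^sub>T\<^sup>-\<^sup>1 v0\<close> off the
  support of \<open>\<theta>0\<close>. On this event the Lasso therefore has support exactly \<open>T\<close> and the Gauss-Lasso
  equals \<open>\<theta>0 + Z\<close>. All quantities involved are linear forms in the Gaussian noise, so Chernoff's
  bound and a union bound conclude. For \<open>p = 1\<close>, where \<open>\<lambda> = 0\<close>, both bounds are trivial.\<close>

section \<open>Inverses of positive definite submatrices\<close>

text \<open>Stated through the quadratic form alone, since positivity of the form is what one
  elimination step passes on to the smaller matrix.\<close>

definition pos_def_on :: "nat set \<Rightarrow> (nat \<Rightarrow> nat \<Rightarrow> real) \<Rightarrow> bool" where
  "pos_def_on I A \<longleftrightarrow> (\<forall>x. (\<exists>i\<in>I. x i \<noteq> 0) \<longrightarrow> 0 < (\<Sum>i\<in>I. x i * (\<Sum>j\<in>I. A i j * x j)))"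

text \<open>Gaussian elimination by induction on the index set: the unit vector at \<open>a\<close>
  shows that the pivot \<open>A a a\<close> is positive, and eliminating it leaves a matrix that is
  again positive definite.\<close>

lemma pos_def_on_solvable:
  assumes "finite I" "pos_def_on I A"
  shows "\<exists>x. \<forall>i\<in>I. (\<Sum>j\<in>I. A i j * x j) = b i"
  using assms
proof (induction I arbitrary: A b rule: finite_induct)
  case empty
  then show ?case by simp
next
  case (insert a I)
  have pos: "A a a > 0"
  proof -
    have "0 < (\<Sum>i\<in>insert a I. (if i = a then 1 else 0) *
        (\<Sum>j\<in>insert a I. A i j * (if j = a then 1 else 0)))"
      using insert.prems unfolding pos_def_on_def
      by (elim allE[of _ "\<lambda>i. if i = a then 1 else 0"]) auto
    then show ?thesis using insert.hyps
      by (simp add: if_distrib[of "\<lambda>x. x * _"] if_distrib[of "\<lambda>x. _ * x"] del: sum.insert cong: if_cong)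
  qed
  \<comment> \<open>\<open>B\<close> is the Schur complement of the pivot; \<open>ext c x\<close>
    chooses coordinate \<open>a\<close> so that row \<open>a\<close> takes the value
    \<open>c\<close>.\<close>
  define B where "B i j = A i j - A i a * A a j / A a a" for i j
  define ext where "ext c x = x(a := (c - (\<Sum>j\<in>I. A a j * x j)) / A a a)" for c :: real and x
  have ext_in: "ext c x i = x i" if "i \<in> I" for c x i
    using that insert.hyps by (auto simp: ext_def)
  have ext_I: "(\<Sum>j\<in>I. A i j * ext c x j) = (\<Sum>j\<in>I. A i j * x j)" for i c x
    using insert.hyps by (intro sum.cong) (auto simp: ext_def)
  have row_a: "(\<Sum>j\<in>insert a I. A a j * ext c x j) = c" for c x
    using insert.hyps pos by (simp add: ext_I) (simp add: ext_def)
  have row: "(\<Sum>j\<in>insert a I. A i j * ext c x j) = A i a * c / A a a + (\<Sum>j\<in>I. B i j * x j)" for i c x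
  proof -
    have "(\<Sum>j\<in>I. B i j * x j) = (\<Sum>j\<in>I. A i j * x j) - (\<Sum>j\<in>I. A i a / A a a * (A a j * x j))"
      by (simp add: B_def sum_subtractf[symmetric] algebra_simps)
    then have "(\<Sum>j\<in>I. B i j * x j) = (\<Sum>j\<in>I. A i j * x j) - A i a / A a a * (\<Sum>j\<in>I. A a j * x j)"
      by (simp add: sum_distrib_left)
    then show ?thesis
      using insert.hyps by (simp add: ext_I) (simp add: ext_def diff_divide_distrib algebra_simps)
  qed
  \<comment> \<open>The form of \<open>B\<close> at \<open>x\<close> is the form of \<open>A\<close>
    at \<open>ext 0 x\<close>, because the choice \<open>c = 0\<close> makes the summand of index
    \<open>a\<close> vanish.\<close>
  have "pos_def_on I B"
    unfolding pos_def_on_def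
  proof (intro allI impI)
    fix x :: "nat \<Rightarrow> real"
    assume "\<exists>i\<in>I. x i \<noteq> 0"
    then have "\<exists>i\<in>insert a I. ext 0 x i \<noteq> 0"
      using insert.hyps by (auto simp: ext_def)
    then have "0 < (\<Sum>i\<in>insert a I. ext 0 x i * (\<Sum>j\<in>insert a I. A i j * ext 0 x j))"
      using insert.prems unfolding pos_def_on_def by blast
    also have "\<dots> = (\<Sum>i\<in>I. ext 0 x i * (\<Sum>j\<in>insert a I. A i j * ext 0 x j))"
      using insert.hyps by (subst sum.insert) (auto simp: row_a simp del: sum.insert)
    also have "\<dots> = (\<Sum>i\<in>I. x i * (\<Sum>j\<in>I. B i j * x j))"
      using insert.hyps by (intro sum.cong refl) (simp add: row ext_in del: sum.insert)
    finally show "0 < (\<Sum>i\<in>I. x i * (\<Sum>j\<in>I. B i j * x j))" .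
  qed
  then obtain x where x: "\<forall>i\<in>I. (\<Sum>j\<in>I. B i j * x j) = b i - A i a * b a / A a a"
    using insert.IH[of B "\<lambda>i. b i - A i a * b a / A a a"] by auto
  have "\<forall>i\<in>insert a I. (\<Sum>j\<in>insert a I. A i j * ext (b a) x j) = b i"
    using x row row_a by auto
  then show ?case by blast
qed

lemma pos_def_on_injective:
  assumes "pos_def_on I A" "\<forall>i\<in>I. (\<Sum>j\<in>I. A i j * x j) = (\<Sum>j\<in>I. A i j * y j)" "i \<in> I"
  shows "x i = y i"
proof (rule ccontr)
  assume "x i \<noteq> y i"
  then have "0 < (\<Sum>i\<in>I. (x i - y i) * (\<Sum>j\<in>I. A i j * (x j - y j)))"
    using assms unfolding pos_def_on_def by (elim allE[of _ "\<lambda>i. x i - y i"]) auto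
  also have "\<dots> = 0"
    using assms by (simp add: right_diff_distrib sum_subtractf)
  finally show False by simp
qed

text \<open>\<open>sub_inv\<close> is a definite description, so existence and uniqueness come
  first. Its columns solve systems with unit vectors on the right; the zero padding off
  \<open>I\<close> makes the function itself unique.\<close>

lemma
  assumes "finite I" "pos_def_on I A"
  shows sub_inv_outside: "i \<notin> I \<or> j \<notin> I \<Longrightarrow> sub_inv A I i j = 0"
    and sub_inv_column: "i \<in> I \<Longrightarrow> j \<in> I \<Longrightarrow> (\<Sum>k\<in>I. A i k * sub_inv A I k j) = (if i = j then 1 else 0)"
proof -
  let ?P = "\<lambda>B. (\<forall>i j. (i \<notin> I \<or> j \<notin> I) \<longrightarrow> B i j = 0) \<and>
       (\<forall>i\<in>I. \<forall>j\<in>I. (\<Sum>k\<in>I. A i k * B k j) = (if i = j then 1 else 0))"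
  have "\<forall>j. \<exists>x. \<forall>i\<in>I. (\<Sum>k\<in>I. A i k * x k) = (if i = j then 1 else 0)"
    by (intro allI pos_def_on_solvable assms)
  then obtain C where C: "\<And>j i. i \<in> I \<Longrightarrow> (\<Sum>k\<in>I. A i k * C j k) = (if i = j then 1 else 0)"
    by metis
  define D where "D i j = (if i \<in> I \<and> j \<in> I then C j i else 0)" for i j
  have D: "?P D" by (auto simp: D_def C)
  have uniq: "B = D" if B: "?P B" for B
  proof (intro ext)
    fix i j
    show "B i j = D i j"
    proof (cases "i \<in> I \<and> j \<in> I")
      case True
      have "\<forall>i\<in>I. (\<Sum>k\<in>I. A i k * B k j) = (\<Sum>k\<in>I. A i k * D k j)"
        using B D True by simp
      then show ?thesis
        using pos_def_on_injective[OF assms(2), of "\<lambda>k. B k j" "\<lambda>k. D k j"] True by blast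
    next
      case False
      then show ?thesis using B D by auto
    qed
  qed
  have "?P (sub_inv A I)"
    unfolding sub_inv_def by (rule theI[of ?P, OF D uniq])
  then show "i \<notin> I \<or> j \<notin> I \<Longrightarrow> sub_inv A I i j = 0"
    and "i \<in> I \<Longrightarrow> j \<in> I \<Longrightarrow> (\<Sum>k\<in>I. A i k * sub_inv A I k j) = (if i = j then 1 else 0)"
    by blast+
qed

lemma sub_inv_right:
  assumes "finite I" "pos_def_on I A" "i \<in> I"
  shows "(\<Sum>j\<in>I. A i j * (\<Sum>k\<in>I. sub_inv A I j k * b k)) = b i"
proof -
  have "(\<Sum>j\<in>I. A i j * (\<Sum>k\<in>I. sub_inv A I j k * b k))
      = (\<Sum>k\<in>I. (\<Sum>j\<in>I. A i j * sub_inv A I j k) * b k)"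
    by (simp add: sum_distrib_left sum_distrib_right mult.assoc) (rule sum.swap)
  also have "\<dots> = (\<Sum>k\<in>I. (if i = k then 1 else 0) * b k)"
    using sub_inv_column[OF assms(1,2)] assms(3) by (intro sum.cong) auto
  finally show ?thesis using assms by (simp add: if_distrib[of "\<lambda>x. x * _"] cong: if_cong)
qed

text \<open>Only a right inverse is built into \<open>sub_inv\<close>; that it also inverts from the
  left follows from injectivity of \<open>A\<close> on \<open>I\<close>.\<close>

lemma sub_inv_left:
  assumes "finite I" "pos_def_on I A" "\<forall>i\<in>I. (\<Sum>j\<in>I. A i j * x j) = b i" "i \<in> I"
  shows "(\<Sum>k\<in>I. sub_inv A I i k * b k) = x i"
  using pos_def_on_injective[OF assms(2) _ assms(4), of "\<lambda>i. \<Sum>k\<in>I. sub_inv A I i k * b k" x]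
    sub_inv_right[OF assms(1,2)] assms(3) by simp

text \<open>Writing the unit vector at \<open>i\<close> as \<open>A\<close> applied to column
  \<open>i\<close> of the inverse turns the entry into the bilinear form of \<open>A\<close> at
  columns \<open>i\<close> and \<open>j\<close>, which is symmetric.\<close>

lemma sub_inv_commute:
  assumes "finite I" "pos_def_on I A" and sym: "\<And>i j. A i j = A j i"
  shows "sub_inv A I i j = sub_inv A I j i"
proof (cases "i \<in> I \<and> j \<in> I")
  case True
  let ?B = "sub_inv A I"
  have "?B i j = (\<Sum>k\<in>I. ?B k j * (if k = i then 1 else 0))"
    using True assms(1) by (simp add: if_distrib[of "\<lambda>x. _ * x"] cong: if_cong)
  also have "\<dots> = (\<Sum>k\<in>I. ?B k j * (\<Sum>l\<in>I. A k l * ?B l i))"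
    using True sub_inv_column[OF assms(1,2)] by (intro sum.cong) auto
  also have "\<dots> = (\<Sum>l\<in>I. ?B l i * (\<Sum>k\<in>I. A l k * ?B k j))"
    unfolding sum_distrib_left
    by (subst sum.swap, intro sum.cong refl) (metis sym mult.commute mult.left_commute)
  also have "\<dots> = (\<Sum>l\<in>I. ?B l i * (if l = j then 1 else 0))"
    using True sub_inv_column[OF assms(1,2)] by (intro sum.cong) auto
  also have "\<dots> = ?B j i"
    using True assms(1) by (simp add: if_distrib[of "\<lambda>x. _ * x"] cong: if_cong)
  finally show ?thesis .
next
  case False
  then show ?thesis using sub_inv_outside[OF assms(1,2)] by auto
qed

section \<open>Gaussian tails of linear forms\<close>

lemma prob_space_noise:
  assumes "\<sigma> > 0"
  shows "prob_space (noise n \<sigma>)"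
  unfolding noise_def using prob_space_normal_density[OF assms] by (intro prob_space_PiM)

lemma linear_form_measurable [measurable]:
  "(\<lambda>W. \<Sum>k<n. a k * W k) \<in> borel_measurable (noise n \<sigma>)"
  unfolding noise_def by measurable

text \<open>Completing the square: tilting by \<open>exp (a * x)\<close> moves the mean to
  \<open>\<sigma>\<^sup>2 * a\<close> and leaves a constant in front of a normal density.\<close>

lemma normal_mgf:
  fixes \<sigma> a :: real
  assumes "\<sigma> > 0"
  shows "(\<integral>\<^sup>+x. ennreal (exp (a * x)) \<partial>density lborel (normal_density 0 \<sigma>)) = ennreal (exp (\<sigma>\<^sup>2 * a\<^sup>2 / 2))"
proof -
  have eq: "normal_density 0 \<sigma> x * exp (a * x) = exp (\<sigma>\<^sup>2 * a\<^sup>2 / 2) * normal_density (\<sigma>\<^sup>2 * a) \<sigma> x" for x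
  proof -
    have "- (x - 0)\<^sup>2 / (2 * \<sigma>\<^sup>2) + a * x = \<sigma>\<^sup>2 * a\<^sup>2 / 2 + - (x - \<sigma>\<^sup>2 * a)\<^sup>2 / (2 * \<sigma>\<^sup>2)"
      using assms by (simp add: field_simps power2_eq_square)
    then have "exp (- (x - 0)\<^sup>2 / (2 * \<sigma>\<^sup>2)) * exp (a * x)
        = exp (\<sigma>\<^sup>2 * a\<^sup>2 / 2) * exp (- (x - \<sigma>\<^sup>2 * a)\<^sup>2 / (2 * \<sigma>\<^sup>2))"
      by (simp only: exp_add[symmetric])
    then show ?thesis by (simp add: normal_density_def)
  qed
  have "(\<integral>\<^sup>+x. ennreal (exp (a * x)) \<partial>density lborel (normal_density 0 \<sigma>))
      = (\<integral>\<^sup>+x. ennreal (normal_density 0 \<sigma> x * exp (a * x)) \<partial>lborel)"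
    by (subst nn_integral_density) (auto simp: ennreal_mult)
  also have "\<dots> = (\<integral>\<^sup>+x. ennreal (exp (\<sigma>\<^sup>2 * a\<^sup>2 / 2)) * ennreal (normal_density (\<sigma>\<^sup>2 * a) \<sigma> x) \<partial>lborel)"
    by (simp add: eq ennreal_mult)
  also have "\<dots> = ennreal (exp (\<sigma>\<^sup>2 * a\<^sup>2 / 2)) * (\<integral>\<^sup>+x. ennreal (normal_density (\<sigma>\<^sup>2 * a) \<sigma> x) \<partial>lborel)"
    by (rule nn_integral_cmult) simp
  also have "(\<integral>\<^sup>+x. ennreal (normal_density (\<sigma>\<^sup>2 * a) \<sigma> x) \<partial>lborel) = 1"
    using assms by (subst nn_integral_eq_integral) auto
  finally show ?thesis by simp
qed

lemma noise_mgf: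
  assumes "\<sigma> > 0"
  shows "(\<integral>\<^sup>+W. ennreal (exp (\<Sum>k<n. a k * W k)) \<partial>noise n \<sigma>) = ennreal (exp (\<sigma>\<^sup>2 * (\<Sum>k<n. (a k)\<^sup>2) / 2))"
proof -
  interpret N: prob_space "density lborel (normal_density 0 \<sigma>)"
    by (rule prob_space_normal_density[OF assms])
  interpret product_sigma_finite "\<lambda>_::nat. density lborel (normal_density 0 \<sigma>)"
    by unfold_locales
  have "(\<integral>\<^sup>+W. ennreal (exp (\<Sum>k<n. a k * W k)) \<partial>noise n \<sigma>)
      = (\<integral>\<^sup>+W. (\<Prod>k<n. ennreal (exp (a k * W k))) \<partial>noise n \<sigma>)"
    by (simp add: exp_sum prod_ennreal)
  also have "\<dots> = (\<Prod>k<n. \<integral>\<^sup>+x. ennreal (exp (a k * x)) \<partial>density lborel (normal_density 0 \<sigma>))"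
    unfolding noise_def by (rule product_nn_integral_prod) auto
  also have "\<dots> = ennreal (exp (\<Sum>k<n. \<sigma>\<^sup>2 * (a k)\<^sup>2 / 2))"
    by (simp add: normal_mgf[OF assms] prod_ennreal exp_sum)
  finally show ?thesis by (simp add: sum_distrib_left sum_divide_distrib)
qed

text \<open>Markov's inequality for the exponential of \<open>s\<close> times the form.
  \<open>V\<close> is a positive upper bound for the variance rather than the variance itself, so a
  vanishing form is covered too.\<close>

lemma noise_upper_tail:
  assumes "\<sigma> > 0" "t > 0" "V > 0" and V: "\<sigma>\<^sup>2 * (\<Sum>k<n. (a k)\<^sup>2) \<le> V"
  shows "measure (noise n \<sigma>) {W \<in> space (noise n \<sigma>). t \<le> (\<Sum>k<n. a k * W k)} \<le> exp (- t\<^sup>2 / (2 * V))"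
proof -
  interpret prob_space "noise n \<sigma>" by (rule prob_space_noise[OF assms(1)])
  \<comment> \<open>The minimizer of the exponent
    \<open>- s * t + s\<^sup>2 * V / 2\<close>.\<close>
  define s where "s = t / V"
  have s: "s > 0" using assms by (simp add: s_def)
  let ?S = "{W \<in> space (noise n \<sigma>). t \<le> (\<Sum>k<n. a k * W k)}"
  have "emeasure (noise n \<sigma>) ?S \<le> emeasure (noise n \<sigma>)
      {W \<in> space (noise n \<sigma>). 1 \<le> ennreal (exp (- s * t)) * ennreal (exp (\<Sum>k<n. (s * a k) * W k))}"
  proof (intro emeasure_mono subsetI)
    fix W assume "W \<in> ?S"
    then have "0 \<le> - s * t + (\<Sum>k<n. (s * a k) * W k)"
      using s by (simp add: sum_distrib_left[symmetric] mult.assoc)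
    then have "1 \<le> exp (- s * t) * exp (\<Sum>k<n. (s * a k) * W k)"
      by (simp only: exp_add[symmetric] one_le_exp_iff)
    then show "W \<in> {W \<in> space (noise n \<sigma>). 1 \<le> ennreal (exp (- s * t)) * ennreal (exp (\<Sum>k<n. (s * a k) * W k))}"
      using \<open>W \<in> ?S\<close> by (simp add: ennreal_mult[symmetric] ennreal_1[symmetric] del: ennreal_1)
  qed measurable
  also have "\<dots> \<le> ennreal (exp (- s * t)) * (\<integral>\<^sup>+W. ennreal (exp (\<Sum>k<n. (s * a k) * W k)) * indicator (space (noise n \<sigma>)) W \<partial>noise n \<sigma>)"
    by (rule order_trans[OF _ nn_integral_Markov_inequality]) auto
  also have "(\<integral>\<^sup>+W. ennreal (exp (\<Sum>k<n. (s * a k) * W k)) * indicator (space (noise n \<sigma>)) W \<partial>noise n \<sigma>)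
      = (\<integral>\<^sup>+W. ennreal (exp (\<Sum>k<n. (s * a k) * W k)) \<partial>noise n \<sigma>)"
    by (intro nn_integral_cong) simp
  also have "ennreal (exp (- s * t)) * \<dots> = ennreal (exp (- s * t + \<sigma>\<^sup>2 * (\<Sum>k<n. (s * a k)\<^sup>2) / 2))"
    by (simp only: noise_mgf[OF assms(1)] exp_add ennreal_mult[symmetric] exp_ge_zero)
  also have "\<dots> \<le> ennreal (exp (- t\<^sup>2 / (2 * V)))"
  proof -
    have "\<sigma>\<^sup>2 * (\<Sum>k<n. (s * a k)\<^sup>2) = s\<^sup>2 * (\<sigma>\<^sup>2 * (\<Sum>k<n. (a k)\<^sup>2))"
      by (simp add: power_mult_distrib sum_distrib_left[symmetric])
    also have "\<dots> \<le> s\<^sup>2 * V" using V by (intro mult_left_mono) auto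
    finally have "- s * t + \<sigma>\<^sup>2 * (\<Sum>k<n. (s * a k)\<^sup>2) / 2 \<le> - s * t + s\<^sup>2 * V / 2" by simp
    also have "\<dots> = - t\<^sup>2 / (2 * V)"
      using assms by (simp add: s_def field_simps power2_eq_square)
    finally show ?thesis by (intro ennreal_leI) simp
  qed
  finally show ?thesis by (simp add: emeasure_eq_measure)
qed

lemma noise_two_sided_tail:
  assumes "\<sigma> > 0" "t > 0" "V > 0" and V: "\<sigma>\<^sup>2 * (\<Sum>k<n. (a k)\<^sup>2) \<le> V"
  shows "measure (noise n \<sigma>) {W \<in> space (noise n \<sigma>). t \<le> \<bar>\<Sum>k<n. a k * W k\<bar>} \<le> 2 * exp (- t\<^sup>2 / (2 * V))"
proof -
  interpret prob_space "noise n \<sigma>" by (rule prob_space_noise[OF assms(1)])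
  let ?L = "{W \<in> space (noise n \<sigma>). t \<le> (\<Sum>k<n. - a k * W k)}"
  let ?U = "{W \<in> space (noise n \<sigma>). t \<le> (\<Sum>k<n. a k * W k)}"
  have "measure (noise n \<sigma>) {W \<in> space (noise n \<sigma>). t \<le> \<bar>\<Sum>k<n. a k * W k\<bar>} \<le> measure (noise n \<sigma>) (?U \<union> ?L)"
    by (intro finite_measure_mono) (auto simp: sum_negf abs_if split: if_splits)
  also have "\<dots> \<le> measure (noise n \<sigma>) ?U + measure (noise n \<sigma>) ?L"
    by (intro measure_Un_le) measurable
  also have "\<dots> \<le> exp (- t\<^sup>2 / (2 * V)) + exp (- t\<^sup>2 / (2 * V))"
    using assms by (intro add_mono noise_upper_tail) auto
  finally show ?thesis by simp
qed

lemma noise_union_tail: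
  assumes "\<sigma> > 0" "t > 0" "V > 0" "finite J"
    and V: "\<And>i. i \<in> J \<Longrightarrow> \<sigma>\<^sup>2 * (\<Sum>k<n. (a i k)\<^sup>2) \<le> V"
  shows "{W \<in> space (noise n \<sigma>). \<exists>i\<in>J. t \<le> \<bar>\<Sum>k<n. a i k * W k\<bar>} \<in> sets (noise n \<sigma>)" (is "?E \<in> _")
    and "measure (noise n \<sigma>) {W \<in> space (noise n \<sigma>). \<exists>i\<in>J. t \<le> \<bar>\<Sum>k<n. a i k * W k\<bar>}
      \<le> real (card J) * (2 * exp (- t\<^sup>2 / (2 * V)))"
proof -
  interpret prob_space "noise n \<sigma>" by (rule prob_space_noise[OF assms(1)])
  let ?F = "\<lambda>i. {W \<in> space (noise n \<sigma>). t \<le> \<bar>\<Sum>k<n. a i k * W k\<bar>}"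
  have eq: "?E = (\<Union>i\<in>J. ?F i)" by auto
  have F: "?F i \<in> sets (noise n \<sigma>)" for i by measurable
  show "?E \<in> sets (noise n \<sigma>)" unfolding eq using F assms(4) by blast
  have "measure (noise n \<sigma>) ?E \<le> (\<Sum>i\<in>J. measure (noise n \<sigma>) (?F i))"
    unfolding eq using F assms(4) by (intro measure_UNION_le) auto
  also have "\<dots> \<le> (\<Sum>i\<in>J. 2 * exp (- t\<^sup>2 / (2 * V)))"
    using assms by (intro sum_mono noise_two_sided_tail) auto
  finally show "measure (noise n \<sigma>) ?E \<le> real (card J) * (2 * exp (- t\<^sup>2 / (2 * V)))" by simp
qed

section \<open>Optimality conditions for the Lasso\<close>

text \<open>The negative gradient of the quadratic loss, so that stationarity equates it with
  \<open>lam\<close> times a subgradient of the l1 norm, without a minus sign.\<close>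

definition lasso_grad :: "nat \<Rightarrow> nat \<Rightarrow> (nat \<Rightarrow> nat \<Rightarrow> real) \<Rightarrow> (nat \<Rightarrow> real) \<Rightarrow> (nat \<Rightarrow> real) \<Rightarrow> nat \<Rightarrow> real" where
  "lasso_grad n p X Y \<theta> j = (\<Sum>k<n. X k j * (Y k - (\<Sum>l<p. X k l * \<theta> l))) / real n"

text \<open>Adjointness: pairing \<open>x\<close> with the transposed design applied to
  \<open>u\<close> is pairing the design applied to \<open>x\<close> with \<open>u\<close>.\<close>

lemma sum_design_swap:
  fixes X :: "nat \<Rightarrow> nat \<Rightarrow> real"
  shows "(\<Sum>i\<in>I. x i * ((\<Sum>k<n. X k i * u k) / real n)) = (\<Sum>k<n. (\<Sum>i\<in>I. X k i * x i) * u k) / real n"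
proof -
  have "(\<Sum>i\<in>I. x i * (\<Sum>k<n. X k i * u k)) = (\<Sum>k<n. (\<Sum>i\<in>I. X k i * x i) * u k)"
    unfolding sum_distrib_left sum_distrib_right
    by (subst sum.swap) (simp add: ac_simps)
  then show ?thesis by (simp add: sum_divide_distrib[symmetric])
qed

text \<open>The loss is quadratic, so its second-order expansion around \<open>\<theta>\<close> is
  exact. Penalty and linear terms are grouped by coordinate so that each can be bounded
  separately.\<close>

lemma lasso_obj_expand:
  assumes "n > 0"
  shows "lasso_obj n p X Y lam \<theta>' = lasso_obj n p X Y lam \<theta>
      + (\<Sum>k<n. (\<Sum>j<p. X k j * (\<theta>' j - \<theta> j))\<^sup>2) / (2 * real n)
      + (\<Sum>j<p. lam * \<bar>\<theta>' j\<bar> - lam * \<bar>\<theta> j\<bar> - lasso_grad n p X Y \<theta> j * (\<theta>' j - \<theta> j))"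
proof -
  define r where "r k = Y k - (\<Sum>l<p. X k l * \<theta> l)" for k
  define e where "e k = (\<Sum>j<p. X k j * (\<theta>' j - \<theta> j))" for k
  have "Y k - (\<Sum>j<p. X k j * \<theta>' j) = r k - e k" for k
    by (simp add: r_def e_def right_diff_distrib sum_subtractf)
  then have sq: "(\<Sum>k<n. (Y k - (\<Sum>j<p. X k j * \<theta>' j))\<^sup>2)
      = (\<Sum>k<n. (r k)\<^sup>2) + (\<Sum>k<n. (e k)\<^sup>2) - 2 * (\<Sum>k<n. e k * r k)"
    by (simp add: power2_diff sum.distrib sum_subtractf sum_distrib_left ac_simps)
  have "(\<Sum>j<p. lasso_grad n p X Y \<theta> j * (\<theta>' j - \<theta> j)) = (\<Sum>k<n. e k * r k) / real n"
    using sum_design_swap[where x = "\<lambda>j. \<theta>' j - \<theta> j" and u = r and I = "{..<p}"]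
    by (simp add: lasso_grad_def r_def e_def mult.commute)
  then have "(\<Sum>j<p. lam * \<bar>\<theta>' j\<bar> - lam * \<bar>\<theta> j\<bar> - lasso_grad n p X Y \<theta> j * (\<theta>' j - \<theta> j))
      = lam * (\<Sum>j<p. \<bar>\<theta>' j\<bar>) - lam * (\<Sum>j<p. \<bar>\<theta> j\<bar>) - (\<Sum>k<n. e k * r k) / real n"
    by (simp add: sum_subtractf sum_distrib_left)
  then show ?thesis
    unfolding lasso_obj_def sq r_def[symmetric] e_def[symmetric]
    using assms by (simp add: field_simps)
qed

text \<open>Strict dual feasibility. In the expansion around \<open>\<theta>\<close> every summand
  is nonnegative, so a competitor that is no worse makes all of them vanish: the strict ones force
  zeros off \<open>T\<close>, the quadratic one forces equal fitted values.\<close>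

lemma lasso_unique:
  assumes "n > 0" "lam > 0"
    and opt: "lasso_obj n p X Y lam \<theta>' \<le> lasso_obj n p X Y lam \<theta>"
    and act: "\<And>j. j < p \<Longrightarrow> j \<in> T \<Longrightarrow> lasso_grad n p X Y \<theta> j = lam * sgn (\<theta> j)"
    and inact: "\<And>j. j < p \<Longrightarrow> j \<notin> T \<Longrightarrow> \<theta> j = 0 \<and> \<bar>lasso_grad n p X Y \<theta> j\<bar> < lam"
  shows "\<And>j. j < p \<Longrightarrow> j \<notin> T \<Longrightarrow> \<theta>' j = 0"
    and "\<And>k. k < n \<Longrightarrow> (\<Sum>j<p. X k j * (\<theta>' j - \<theta> j)) = 0"
proof -
  let ?g = "lasso_grad n p X Y \<theta>"
  let ?t = "\<lambda>j. lam * \<bar>\<theta>' j\<bar> - lam * \<bar>\<theta> j\<bar> - ?g j * (\<theta>' j - \<theta> j)"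
  let ?Q = "\<Sum>k<n. (\<Sum>j<p. X k j * (\<theta>' j - \<theta> j))\<^sup>2"
  have strict: "0 < ?t j" if "j < p" "j \<notin> T" "\<theta>' j \<noteq> 0" for j
  proof -
    have "?g j * \<theta>' j \<le> \<bar>?g j\<bar> * \<bar>\<theta>' j\<bar>" by (metis abs_ge_self abs_mult)
    also have "\<dots> < lam * \<bar>\<theta>' j\<bar>" using inact[OF that(1,2)] that(3) by simp
    finally show ?thesis using inact[OF that(1,2)] by simp
  qed
  have nonneg: "0 \<le> ?t j" if "j < p" for j
  proof (cases "j \<in> T")
    case True
    have "sgn (\<theta> j) * \<theta>' j \<le> \<bar>\<theta>' j\<bar>"
      by (cases "\<theta> j" "0 :: real" rule: linorder_cases) auto
    then have "lam * (sgn (\<theta> j) * \<theta>' j) \<le> lam * \<bar>\<theta>' j\<bar>"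
      using assms(2) by (intro mult_left_mono) auto
    moreover have "lam * \<bar>\<theta> j\<bar> = lam * (sgn (\<theta> j) * \<theta> j)"
      by (simp add: abs_sgn mult.commute)
    moreover have "lam * sgn (\<theta> j) * (\<theta>' j - \<theta> j) = lam * (sgn (\<theta> j) * \<theta>' j) - lam * (sgn (\<theta> j) * \<theta> j)"
      by (simp add: algebra_simps)
    ultimately show ?thesis unfolding act[OF that True] by linarith
  next
    case False
    then show ?thesis using strict[OF that False] inact[OF that False] by (cases "\<theta>' j = 0") auto
  qed
  have Q: "0 \<le> ?Q" by (intro sum_nonneg) auto
  have t: "0 \<le> (\<Sum>j<p. ?t j)" using nonneg by (intro sum_nonneg) auto
  have "?Q / (2 * real n) + (\<Sum>j<p. ?t j) \<le> 0"
    using opt unfolding lasso_obj_expand[OF assms(1), of p X Y lam \<theta>' \<theta>] by simp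
  moreover have "0 \<le> ?Q / (2 * real n)" using Q by simp
  ultimately have "?Q / (2 * real n) = 0" and t0: "(\<Sum>j<p. ?t j) = 0" using t by linarith+
  then have Q0: "?Q = 0" using assms(1) by simp
  show "\<theta>' j = 0" if "j < p" "j \<notin> T" for j
  proof (rule ccontr)
    assume "\<theta>' j \<noteq> 0"
    then have "0 < ?t j" using strict that by blast
    moreover have "?t j = 0"
      using t0 nonneg that(1) by (subst (asm) sum_nonneg_eq_0_iff) auto
    ultimately show False by simp
  qed
  show "(\<Sum>j<p. X k j * (\<theta>' j - \<theta> j)) = 0" if "k < n" for k
    using Q0 that by (subst (asm) sum_nonneg_eq_0_iff) auto
qed

text \<open>Moving coordinate \<open>j\<close> alone by less than its modulus keeps its sign, so the
  objective changes by exactly \<open>D * t\<^sup>2 + c * t\<close>. A local minimum at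
  \<open>0\<close> forces the derivative \<open>c\<close> to vanish.\<close>

lemma lasso_stationary:
  assumes "n > 0" and opt: "\<And>\<theta>'. lasso_obj n p X Y lam \<theta> \<le> lasso_obj n p X Y lam \<theta>'"
    and j: "j < p" "\<theta> j \<noteq> 0"
  shows "lasso_grad n p X Y \<theta> j = lam * sgn (\<theta> j)"
proof -
  define c where "c = lam * sgn (\<theta> j) - lasso_grad n p X Y \<theta> j"
  define D where "D = (\<Sum>k<n. (X k j)\<^sup>2) / (2 * real n)"
  have ineq: "0 \<le> D * t\<^sup>2 + c * t" if t: "\<bar>t\<bar> < \<bar>\<theta> j\<bar>" for t
  proof -
    define \<theta>' where "\<theta>' = \<theta>(j := \<theta> j + t)"
    have diff: "\<theta>' l - \<theta> l = (if l = j then t else 0)" for l by (simp add: \<theta>'_def)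
    have "(\<Sum>l<p. X k l * (\<theta>' l - \<theta> l)) = X k j * t" for k
      using j by (simp add: diff if_distrib[of "\<lambda>x. _ * x"] cong: if_cong)
    then have 1: "(\<Sum>k<n. (\<Sum>l<p. X k l * (\<theta>' l - \<theta> l))\<^sup>2) / (2 * real n) = D * t\<^sup>2"
      by (simp add: D_def power_mult_distrib sum_distrib_right)
    have "lam * \<bar>\<theta>' l\<bar> - lam * \<bar>\<theta> l\<bar> - lasso_grad n p X Y \<theta> l * (\<theta>' l - \<theta> l)
        = (if l = j then c * t else 0)" for l
    proof (cases "l = j")
      case True
      have "\<bar>\<theta> j + t\<bar> = \<bar>\<theta> j\<bar> + sgn (\<theta> j) * t"
        using t by (auto simp: abs_if sgn_if split: if_splits)
      then show ?thesis using True by (simp add: diff c_def algebra_simps \<theta>'_def)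
    qed (simp add: \<theta>'_def)
    then have 2: "(\<Sum>l<p. lam * \<bar>\<theta>' l\<bar> - lam * \<bar>\<theta> l\<bar> - lasso_grad n p X Y \<theta> l * (\<theta>' l - \<theta> l)) = c * t"
      using j by simp
    show ?thesis
      using opt[of \<theta>'] unfolding lasso_obj_expand[OF assms(1), of p X Y lam \<theta>' \<theta>] 1 2 by simp
  qed
  have "((\<lambda>t. D * t\<^sup>2 + c * t) has_real_derivative c) (at 0)"
    by (auto intro!: derivative_eq_intros)
  then have "c = 0"
    by (rule DERIV_local_min[where d = "\<bar>\<theta> j\<bar>"]) (use j ineq in auto)
  then show ?thesis by (simp add: c_def)
qed

section \<open>The design matrix restricted to the active set\<close>

lemma Sigma_hat_commute: "Sigma_hat n p X i j = Sigma_hat n p X j i"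
  by (simp add: Sigma_hat_def mult.commute)

lemma Sigma_hat_apply:
  "(\<Sum>j\<in>I. Sigma_hat n p X i j * x j) = (\<Sum>k<n. X k i * (\<Sum>j\<in>I. X k j * x j)) / real n"
  using sum_design_swap[where u = "\<lambda>k. X k i"]
  by (simp add: Sigma_hat_def mult.commute)

lemma Sigma_hat_quadratic_form:
  "(\<Sum>i\<in>I. x i * (\<Sum>j\<in>I. Sigma_hat n p X i j * x j)) = (\<Sum>k<n. (\<Sum>j\<in>I. X k j * x j)\<^sup>2) / real n"
  unfolding Sigma_hat_apply sum_design_swap power2_eq_square ..

text \<open>Makes \<open>lasso_stationary\<close> available for the zero-noise problem.\<close>

lemma zn_obj_eq_lasso_obj:
  "zn_obj p (Sigma_hat n p X) \<theta>0 \<xi> \<theta> = lasso_obj n p X (\<lambda>k. \<Sum>j<p. X k j * \<theta>0 j) \<xi> \<theta>"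
proof -
  have "(\<Sum>i<p. \<Sum>j<p. (\<theta> i - \<theta>0 i) * Sigma_hat n p X i j * (\<theta> j - \<theta>0 j))
      = (\<Sum>k<n. (\<Sum>j<p. X k j * (\<theta> j - \<theta>0 j))\<^sup>2) / real n"
    using Sigma_hat_quadratic_form[of "\<lambda>i. \<theta> i - \<theta>0 i" n p X "{..<p}"]
    by (simp add: sum_distrib_left mult.assoc)
  also have "\<dots> = (\<Sum>k<n. ((\<Sum>j<p. X k j * \<theta>0 j) - (\<Sum>j<p. X k j * \<theta> j))\<^sup>2) / real n"
    by (simp add: right_diff_distrib sum_subtractf power2_commute)
  finally show ?thesis by (simp add: zn_obj_def lasso_obj_def)
qed

text \<open>Homogeneity extends the infimum over unit vectors to all vectors; the zero vector, which
  cannot be normalised, is a separate case.\<close>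

lemma sigma_min_sub_bound:
  assumes "finite I" "0 \<le> C" "C \<le> sigma_min_sub A I"
  shows "C\<^sup>2 * (\<Sum>j\<in>I. (x j)\<^sup>2) \<le> (\<Sum>i\<in>I. (\<Sum>j\<in>I. A i j * x j)\<^sup>2)"
proof (cases "(\<Sum>j\<in>I. (x j)\<^sup>2) = 0")
  case True
  then show ?thesis by (simp add: sum_nonneg)
next
  case False
  define N where "N = (\<Sum>j\<in>I. (x j)\<^sup>2)"
  have N: "N > 0" using False by (simp add: N_def sum_nonneg order_less_le)
  define y where "y j = x j / sqrt N" for j
  let ?S = "{sqrt (\<Sum>i\<in>I. (\<Sum>j\<in>I. A i j * x j)^2) | x. (\<Sum>j\<in>I. (x j)^2) = 1}"
  have y: "(\<Sum>j\<in>I. (y j)\<^sup>2) = 1"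
    using N by (simp add: y_def power_divide sum_divide_distrib[symmetric] N_def[symmetric])
  have Ay: "(\<Sum>i\<in>I. (\<Sum>j\<in>I. A i j * y j)\<^sup>2) = (\<Sum>i\<in>I. (\<Sum>j\<in>I. A i j * x j)\<^sup>2) / N"
    using N by (simp add: y_def power_divide sum_divide_distrib[symmetric])
  have "bdd_below ?S" by (rule bdd_belowI[of _ 0]) (auto simp: sum_nonneg)
  then have "C \<le> sqrt (\<Sum>i\<in>I. (\<Sum>j\<in>I. A i j * y j)\<^sup>2)"
    using assms(3) unfolding sigma_min_sub_def by (rule order_trans[OF _ cInf_lower, rotated 2]) (use y in blast)
  then have "C\<^sup>2 \<le> (\<Sum>i\<in>I. (\<Sum>j\<in>I. A i j * y j)\<^sup>2)"
    using assms(2) by (metis real_le_rsqrt real_sqrt_le_iff real_sqrt_abs abs_of_nonneg)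
  then show ?thesis unfolding Ay using N by (simp add: field_simps N_def)
qed

text \<open>Only the design and the active set are fixed here; noise and signs enter as arguments,
  so every fact below is deterministic.\<close>

locale lasso_design =
  fixes n p :: nat and X :: "nat \<Rightarrow> nat \<Rightarrow> real" and T :: "nat set" and C :: real
  assumes n_pos: "n > 0" and T_sub: "T \<subseteq> {..<p}" and C_pos: "C > 0"
    and sigma_min: "C \<le> sigma_min_sub (Sigma_hat n p X) T"
begin

abbreviation "Sig \<equiv> Sigma_hat n p X"
abbreviation "B \<equiv> sub_inv Sig T"

lemma finite_T: "finite T"
  using T_sub finite_subset by blast

lemma sum_restrict:
  assumes "\<And>j. j < p \<Longrightarrow> j \<notin> T \<Longrightarrow> x j = 0"
  shows "(\<Sum>j<p. X k j * x j) = (\<Sum>j\<in>T. X k j * x j)"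
  using T_sub assms by (intro sum.mono_neutral_right) auto

text \<open>A combination of the columns in \<open>T\<close> that vanishes is also annihilated by
  the submatrix of \<open>Sig\<close>, where the singular value bound forces it to be
  trivial.\<close>

lemma X_injective:
  assumes "\<And>k. k < n \<Longrightarrow> (\<Sum>j\<in>T. X k j * x j) = 0" "i \<in> T"
  shows "x i = 0"
proof -
  have "(\<Sum>j\<in>T. Sig i j * x j) = 0" for i
    using assms(1) by (simp add: Sigma_hat_apply)
  then have "C\<^sup>2 * (\<Sum>j\<in>T. (x j)\<^sup>2) \<le> 0"
    using sigma_min_sub_bound[OF finite_T _ sigma_min, of x] C_pos by simp
  then have "(\<Sum>j\<in>T. (x j)\<^sup>2) \<le> 0"
    using C_pos by (simp add: mult_le_0_iff)
  moreover have "(x i)\<^sup>2 \<le> (\<Sum>j\<in>T. (x j)\<^sup>2)"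
    using finite_T assms(2) by (intro member_le_sum) auto
  ultimately have "(x i)\<^sup>2 \<le> 0" by linarith
  then show ?thesis by simp
qed

lemma X_quadratic_pos:
  assumes "\<exists>i\<in>T. x i \<noteq> 0"
  shows "0 < (\<Sum>k<n. (\<Sum>j\<in>T. X k j * x j)\<^sup>2)"
proof -
  have "\<exists>k<n. (\<Sum>j\<in>T. X k j * x j) \<noteq> 0" using X_injective[of x] assms by blast
  then show ?thesis by (auto intro!: sum_pos2)
qed

lemma pos_def_Sig: "pos_def_on T Sig"
  using X_quadratic_pos n_pos by (simp add: pos_def_on_def Sigma_hat_quadratic_form)

lemma gram_apply: "(\<Sum>j\<in>T. (\<Sum>k<n. X k i * X k j) * x j) = real n * (\<Sum>j\<in>T. Sig i j * x j)"
  using n_pos by (simp add: Sigma_hat_def sum_divide_distrib[symmetric])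

text \<open>\<open>gauss_lasso\<close> inverts the Gram matrix without the factor
  \<open>1 / n\<close>, so positivity has to be transferred to that scaling.\<close>

lemma pos_def_gram: "pos_def_on T (\<lambda>a b. \<Sum>k<n. X k a * X k b)"
proof -
  have "(\<Sum>i\<in>T. x i * (\<Sum>j\<in>T. (\<Sum>k<n. X k i * X k j) * x j))
      = real n * (\<Sum>i\<in>T. x i * (\<Sum>j\<in>T. Sig i j * x j))" for x
    unfolding gram_apply by (simp add: sum_distrib_left mult.left_commute)
  then show ?thesis
    using pos_def_Sig n_pos by (simp add: pos_def_on_def)
qed

lemma B_commute: "B i j = B j i"
  by (rule sub_inv_commute[OF finite_T pos_def_Sig Sigma_hat_commute])

text \<open>\<open>Sig\<close> maps column \<open>i\<close> of \<open>B\<close> to a unit vector, so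
  the singular value bound limits the norm of that column to \<open>1 / C\<close>; the diagonal
  entry is one of its coordinates.\<close>

lemma B_diag_le:
  assumes "i \<in> T"
  shows "B i i \<le> 1 / C"
proof -
  have "C\<^sup>2 * (\<Sum>j\<in>T. (B j i)\<^sup>2) \<le> (\<Sum>l\<in>T. (\<Sum>j\<in>T. Sig l j * B j i)\<^sup>2)"
    using sigma_min_sub_bound[OF finite_T _ sigma_min, of "\<lambda>j. B j i"] C_pos by simp
  also have "\<dots> = (\<Sum>l\<in>T. if l = i then 1 else 0)"
    using sub_inv_column[OF finite_T pos_def_Sig _ assms] by (intro sum.cong) auto
  also have "\<dots> = 1" using assms finite_T by simp
  finally have "C\<^sup>2 * (\<Sum>j\<in>T. (B j i)\<^sup>2) \<le> 1" .
  moreover have "C\<^sup>2 * (B i i)\<^sup>2 \<le> C\<^sup>2 * (\<Sum>j\<in>T. (B j i)\<^sup>2)"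
    using finite_T assms member_le_sum[of i T "\<lambda>j. (B j i)\<^sup>2"] by (intro mult_left_mono) auto
  ultimately have "(C * B i i)\<^sup>2 \<le> 1\<^sup>2" by (simp add: power_mult_distrib)
  then have "C * B i i \<le> 1" by (rule power2_le_imp_le) simp
  then show ?thesis using C_pos by (simp add: field_simps)
qed

text \<open>Weights that display the vector \<open>Z\<close> of the overview, called
  \<open>ls_error W\<close> below, as linear forms in the noise, ready for the Gaussian tail
  bounds.\<close>

definition ls_coeff :: "nat \<Rightarrow> nat \<Rightarrow> real" where
  "ls_coeff i k = (\<Sum>j\<in>T. X k j * B i j) / real n"

definition ls_error :: "(nat \<Rightarrow> real) \<Rightarrow> nat \<Rightarrow> real" where
  "ls_error W i = (\<Sum>k<n. ls_coeff i k * W k)"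

lemma ls_error_eq: "ls_error W i = (\<Sum>j\<in>T. B i j * ((\<Sum>k<n. X k j * W k) / real n))"
  unfolding sum_design_swap by (simp add: ls_error_def ls_coeff_def sum_divide_distrib[symmetric])

lemma ls_error_normal_eq:
  assumes "i \<in> T"
  shows "(\<Sum>j\<in>T. Sig i j * ls_error W j) = (\<Sum>k<n. X k i * W k) / real n"
  unfolding ls_error_eq by (rule sub_inv_right[OF finite_T pos_def_Sig assms])

text \<open>The squared norm is the quadratic form of \<open>Sig\<close> at row \<open>i\<close> of
  \<open>B\<close>, divided by \<open>n\<close>; since \<open>B\<close> inverts \<open>Sig\<close>,
  this collapses to \<open>B i i / n\<close>.\<close>

lemma ls_coeff_norm:
  assumes "i \<in> T"
  shows "(\<Sum>k<n. (ls_coeff i k)\<^sup>2) \<le> 1 / (real n * C)"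
proof -
  have "(\<Sum>k<n. (ls_coeff i k)\<^sup>2) = (\<Sum>k<n. (\<Sum>j\<in>T. X k j * B i j)\<^sup>2) / real n / real n"
    by (simp add: ls_coeff_def power_divide sum_divide_distrib[symmetric] power2_eq_square)
  also have "\<dots> = (\<Sum>l\<in>T. B i l * (\<Sum>j\<in>T. Sig l j * B i j)) / real n"
    by (simp only: Sigma_hat_quadratic_form)
  also have "(\<Sum>l\<in>T. B i l * (\<Sum>j\<in>T. Sig l j * B i j)) = (\<Sum>l\<in>T. B i l * (if l = i then 1 else 0))"
  proof (intro sum.cong refl arg_cong2[where f = "(*)"])
    fix l assume l: "l \<in> T"
    have "(\<Sum>j\<in>T. Sig l j * B i j) = (\<Sum>j\<in>T. Sig l j * B j i)"
      by (intro sum.cong refl) (metis B_commute)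
    then show "(\<Sum>j\<in>T. Sig l j * B i j) = (if l = i then 1 else 0)"
      using sub_inv_column[OF finite_T pos_def_Sig l assms] by simp
  qed
  also have "\<dots> = B i i"
    using assms finite_T by (simp add: if_distrib[of "\<lambda>x. _ * x"] cong: if_cong)
  also have "B i i / real n \<le> 1 / C / real n"
    using B_diag_le[OF assms] by (intro divide_right_mono) auto
  finally show ?thesis by (simp add: mult.commute)
qed

text \<open>\<^term>\<open>proj_coeff i\<close> holds the coordinates of the orthogonal projection of column \<^term>\<open>i\<close>
  onto the span of the columns in \<^term>\<open>T\<close>.\<close>

definition proj_coeff :: "nat \<Rightarrow> nat \<Rightarrow> real" where
  "proj_coeff i j = (\<Sum>l\<in>T. B j l * Sig l i)"

text \<open>Projecting the column rather than the noise makes the correlation with the projected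
  noise an explicit linear form in \<open>W\<close>.\<close>

definition resid_coeff :: "nat \<Rightarrow> nat \<Rightarrow> real" where
  "resid_coeff i k = (X k i - (\<Sum>j\<in>T. X k j * proj_coeff i j)) / real n"

lemma proj_coeff_normal_eq: "l \<in> T \<Longrightarrow> (\<Sum>j\<in>T. Sig l j * proj_coeff i j) = Sig l i"
  unfolding proj_coeff_def by (rule sub_inv_right[OF finite_T pos_def_Sig])

text \<open>Self-adjointness of the projection: the normal equations of \<open>proj_coeff\<close>
  and those of \<open>ls_error\<close> are inserted on the two sides of one bilinear sum.\<close>

lemma resid_coeff_apply:
  "(\<Sum>k<n. resid_coeff i k * W k) = (\<Sum>k<n. X k i * W k) / real n - (\<Sum>j\<in>T. Sig i j * ls_error W j)"
proof -
  have "(\<Sum>j\<in>T. Sig i j * ls_error W j) = (\<Sum>j\<in>T. (\<Sum>l\<in>T. Sig j l * proj_coeff i l) * ls_error W j)"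
    by (intro sum.cong refl) (simp add: proj_coeff_normal_eq Sigma_hat_commute)
  also have "\<dots> = (\<Sum>l\<in>T. proj_coeff i l * (\<Sum>j\<in>T. Sig l j * ls_error W j))"
    unfolding sum_distrib_left sum_distrib_right
    by (subst sum.swap, intro sum.cong refl) (metis Sigma_hat_commute mult.commute mult.left_commute)
  also have "\<dots> = (\<Sum>l\<in>T. proj_coeff i l * ((\<Sum>k<n. X k l * W k) / real n))"
    by (intro sum.cong refl) (simp add: ls_error_normal_eq)
  also have "\<dots> = (\<Sum>k<n. (\<Sum>j\<in>T. X k j * proj_coeff i j) * W k) / real n"
    by (rule sum_design_swap)
  finally show ?thesis
    by (simp add: resid_coeff_def left_diff_distrib sum_subtractf diff_divide_distrib sum_divide_distrib[symmetric])
qed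

text \<open>Pythagoras: with \<open>u\<close> the projection of column \<open>i\<close>, the
  identity \<open>orth\<close> says that the residual is orthogonal to \<open>u\<close>, so it is no
  longer than the column.\<close>

lemma resid_coeff_norm: "(\<Sum>k<n. (resid_coeff i k)\<^sup>2) \<le> Sig i i / real n"
proof -
  define u where "u k = (\<Sum>j\<in>T. X k j * proj_coeff i j)" for k
  have "(\<Sum>k<n. u k * X k i) / real n = (\<Sum>l\<in>T. proj_coeff i l * Sig l i)"
    using sum_design_swap[where x = "proj_coeff i" and u = "\<lambda>k. X k i"] by (simp add: u_def Sigma_hat_def)
  also have "\<dots> = (\<Sum>l\<in>T. proj_coeff i l * (\<Sum>j\<in>T. Sig l j * proj_coeff i j))"
    by (intro sum.cong refl) (simp add: proj_coeff_normal_eq)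
  also have "\<dots> = (\<Sum>k<n. (u k)\<^sup>2) / real n"
    by (simp add: Sigma_hat_quadratic_form u_def)
  finally have orth: "(\<Sum>k<n. u k * X k i) = (\<Sum>k<n. (u k)\<^sup>2)" using n_pos by simp
  have "(\<Sum>k<n. (X k i - u k)\<^sup>2) = (\<Sum>k<n. (X k i)\<^sup>2) + (\<Sum>k<n. (u k)\<^sup>2) - 2 * (\<Sum>k<n. u k * X k i)"
    by (simp add: power2_diff sum.distrib sum_subtractf sum_distrib_left ac_simps)
  also have "\<dots> = (\<Sum>k<n. (X k i)\<^sup>2) - (\<Sum>k<n. (u k)\<^sup>2)" by (simp add: orth)
  also have "\<dots> \<le> (\<Sum>k<n. (X k i)\<^sup>2)" by (simp add: sum_nonneg)
  finally have "(\<Sum>k<n. (X k i - u k)\<^sup>2) / (real n)\<^sup>2 \<le> (\<Sum>k<n. (X k i)\<^sup>2) / (real n)\<^sup>2"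
    by (intro divide_right_mono) auto
  then show ?thesis
    by (simp add: resid_coeff_def u_def Sigma_hat_def power_divide sum_divide_distrib[symmetric] power2_eq_square)
qed

text \<open>Primal-dual witness: an explicit candidate with support \<open>T\<close> satisfies the
  optimality conditions, strictly off \<open>T\<close>, and uniqueness identifies every Lasso
  solution with it on \<open>[p]\<close>.\<close>

lemma lasso_support:
  assumes lam: "lam > 0"
    and \<theta>0: "\<And>j. j < p \<Longrightarrow> j \<notin> T \<Longrightarrow> \<theta>0 j = 0"
    and signs: "\<And>i. i \<in> T \<Longrightarrow> v i \<noteq> 0 \<and>
      sgn (\<theta>0 i + ls_error W i - lam * (\<Sum>k\<in>T. B i k * v k)) = v i"
    and irr: "\<And>i. i < p \<Longrightarrow> i \<notin> T \<Longrightarrow> \<bar>\<Sum>j\<in>T. Sig i j * (\<Sum>k\<in>T. B j k * v k)\<bar> \<le> 1 - \<eta>"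
    and resid: "\<And>i. i < p \<Longrightarrow> i \<notin> T \<Longrightarrow> \<bar>\<Sum>k<n. resid_coeff i k * W k\<bar> < lam * \<eta>"
    and opt: "is_lasso n p X (\<lambda>i. (\<Sum>j<p. X i j * \<theta>0 j) + W i) lam \<theta>'"
  shows "supp p \<theta>' = T"
proof -
  define Y where "Y = (\<lambda>i. (\<Sum>j<p. X i j * \<theta>0 j) + W i)"
  define q where "q i = (\<Sum>k\<in>T. B i k * v k)" for i
  define d where "d i = ls_error W i - lam * q i" for i
  define \<theta> where "\<theta> i = (if i \<in> T then \<theta>0 i + d i else 0)" for i
  have q: "(\<Sum>j\<in>T. Sig i j * q j) = v i" if "i \<in> T" for i
    unfolding q_def by (rule sub_inv_right[OF finite_T pos_def_Sig that])
  have sgn\<theta>: "sgn (\<theta> i) = v i" "v i \<noteq> 0" if "i \<in> T" for i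
    using signs[OF that] that by (simp_all add: \<theta>_def d_def q_def algebra_simps)
  have res: "Y k - (\<Sum>l<p. X k l * \<theta> l) = W k - (\<Sum>j\<in>T. X k j * d j)" for k
  proof -
    have "(\<Sum>l<p. X k l * \<theta> l) = (\<Sum>l\<in>T. X k l * \<theta> l)"
      by (rule sum_restrict) (simp add: \<theta>_def)
    also have "\<dots> = (\<Sum>l\<in>T. X k l * \<theta>0 l) + (\<Sum>l\<in>T. X k l * d l)"
      by (simp add: \<theta>_def distrib_left sum.distrib)
    also have "(\<Sum>l\<in>T. X k l * \<theta>0 l) = (\<Sum>l<p. X k l * \<theta>0 l)"
      using sum_restrict[of \<theta>0 k] \<theta>0 by simp
    finally show ?thesis by (simp add: Y_def)
  qed
  \<comment> \<open>The first term is the noise orthogonal to the active columns, which vanishes for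
    \<open>i\<close> in \<open>T\<close>; the second is the bias of the penalty, equal to
    \<open>lam * v i\<close> there.\<close>
  have grad: "lasso_grad n p X Y \<theta> i
      = (\<Sum>k<n. resid_coeff i k * W k) + lam * (\<Sum>j\<in>T. Sig i j * q j)" for i
  proof -
    have "lasso_grad n p X Y \<theta> i = (\<Sum>k<n. X k i * W k) / real n - (\<Sum>j\<in>T. Sig i j * d j)"
      by (simp add: lasso_grad_def res Sigma_hat_apply right_diff_distrib sum_subtractf diff_divide_distrib)
    also have "(\<Sum>j\<in>T. Sig i j * d j) = (\<Sum>j\<in>T. Sig i j * ls_error W j) - lam * (\<Sum>j\<in>T. Sig i j * q j)"
      by (simp add: d_def right_diff_distrib sum_subtractf sum_distrib_left ac_simps)
    finally show ?thesis by (simp add: resid_coeff_apply)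
  qed
  have act: "lasso_grad n p X Y \<theta> j = lam * sgn (\<theta> j)" if "j \<in> T" for j
    using that by (simp add: grad q sgn\<theta> resid_coeff_apply ls_error_normal_eq)
  have inact: "\<theta> j = 0 \<and> \<bar>lasso_grad n p X Y \<theta> j\<bar> < lam" if "j < p" "j \<notin> T" for j
  proof -
    \<comment> \<open>The bias uses at most \<open>lam * (1 - \<eta>)\<close>, which leaves exactly
      \<open>lam * \<eta>\<close> for the noise term.\<close>
    have "\<bar>lam * (\<Sum>l\<in>T. Sig j l * q l)\<bar> \<le> lam * (1 - \<eta>)"
      using irr[OF that] lam by (simp add: abs_mult q_def)
    then have "\<bar>lasso_grad n p X Y \<theta> j\<bar> < lam * \<eta> + lam * (1 - \<eta>)"
      unfolding grad using resid[OF that] by linarith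
    then show ?thesis using that by (simp add: \<theta>_def algebra_simps)
  qed
  have "lasso_obj n p X Y lam \<theta>' \<le> lasso_obj n p X Y lam \<theta>"
    using opt by (simp add: is_lasso_def Y_def)
  note uniq = lasso_unique[OF n_pos lam this act inact]
  \<comment> \<open>Uniqueness gives only equal fitted values; injectivity on \<open>T\<close> turns
    them into equal coefficients.\<close>
  have "\<theta>' i = \<theta> i" if "i \<in> T" for i
  proof -
    have "(\<Sum>j\<in>T. X k j * (\<theta>' j - \<theta> j)) = 0" if "k < n" for k
      using uniq(2)[OF _ _ _ that] uniq(1) sum_restrict[of "\<lambda>j. \<theta>' j - \<theta> j" k] by (simp add: \<theta>_def)
    then show ?thesis using X_injective[of "\<lambda>j. \<theta>' j - \<theta> j" i] that by simp
  qed
  then have "i \<in> T \<Longrightarrow> \<theta>' i \<noteq> 0" for i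
    using sgn\<theta> by (metis sgn_zero)
  then show ?thesis
    using uniq(1) T_sub by (auto simp: supp_def)
qed

text \<open>Once the support is right, \<open>\<theta>0 + Z\<close> solves the normal equations of
  least squares on \<open>T\<close>, and the left inverse recovers it.\<close>

lemma gauss_lasso_eq:
  assumes \<theta>0: "\<And>j. j < p \<Longrightarrow> j \<notin> T \<Longrightarrow> \<theta>0 j = 0" and supp: "supp p \<theta>' = T"
  shows "gauss_lasso n p X (\<lambda>i. (\<Sum>j<p. X i j * \<theta>0 j) + W i) \<theta>' i
    = (if i \<in> T then \<theta>0 i + ls_error W i else 0)"
proof (cases "i \<in> T")
  case True
  let ?G = "\<lambda>a b. \<Sum>k<n. X k a * X k b"
  have "\<forall>l\<in>T. (\<Sum>j\<in>T. ?G l j * (\<theta>0 j + ls_error W j))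
      = (\<Sum>k<n. X k l * ((\<Sum>j<p. X k j * \<theta>0 j) + W k))"
  proof
    fix l assume l: "l \<in> T"
    have "(\<Sum>j\<in>T. ?G l j * (\<theta>0 j + ls_error W j))
        = real n * (\<Sum>j\<in>T. Sig l j * \<theta>0 j) + real n * (\<Sum>j\<in>T. Sig l j * ls_error W j)"
      unfolding gram_apply by (simp add: distrib_left sum.distrib)
    also have "\<dots> = (\<Sum>k<n. X k l * (\<Sum>j\<in>T. X k j * \<theta>0 j)) + (\<Sum>k<n. X k l * W k)"
      using n_pos unfolding ls_error_normal_eq[OF l] unfolding Sigma_hat_apply by simp
    also have "\<dots> = (\<Sum>k<n. X k l * ((\<Sum>j<p. X k j * \<theta>0 j) + W k))"
      using sum_restrict[of \<theta>0] \<theta>0 by (simp add: distrib_left sum.distrib)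
    finally show "(\<Sum>j\<in>T. ?G l j * (\<theta>0 j + ls_error W j))
      = (\<Sum>k<n. X k l * ((\<Sum>j<p. X k j * \<theta>0 j) + W k))" .
  qed
  then show ?thesis
    using sub_inv_left[OF finite_T pos_def_gram _ True] True supp
    by (simp add: gauss_lasso_def Let_def)
next
  case False
  then show ?thesis by (simp add: gauss_lasso_def Let_def supp)
qed

text \<open>Stationarity of the zero-noise problem on \<open>T\<close>, multiplied by
  \<open>B\<close>. Where \<open>\<theta>0 i = 0\<close> the right-hand side is
  \<open>- \<theta> i\<close>, which reveals the sign of the bias.\<close>

lemma zn_error:
  assumes zn: "is_zn p Sig \<theta>0 \<xi> \<theta>" and supp: "supp p \<theta> = T"
    and \<theta>0: "\<And>j. j < p \<Longrightarrow> j \<notin> T \<Longrightarrow> \<theta>0 j = 0" and i: "i \<in> T"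
  shows "\<xi> * (\<Sum>k\<in>T. B i k * sgn (\<theta> k)) = \<theta>0 i - \<theta> i"
proof -
  let ?Y = "\<lambda>k. \<Sum>j<p. X k j * \<theta>0 j"
  have "(\<Sum>l\<in>T. Sig j l * (\<theta>0 l - \<theta> l)) = \<xi> * sgn (\<theta> j)" if "j \<in> T" for j
  proof -
    have j: "j < p" "\<theta> j \<noteq> 0" using that supp by (auto simp: supp_def)
    have "(\<Sum>l<p. X k l * \<theta>0 l) - (\<Sum>l<p. X k l * \<theta> l) = (\<Sum>l\<in>T. X k l * (\<theta>0 l - \<theta> l))" for k
    proof -
      have "(\<Sum>l<p. X k l * (\<theta>0 l - \<theta> l)) = (\<Sum>l\<in>T. X k l * (\<theta>0 l - \<theta> l))"
        using \<theta>0 supp by (intro sum_restrict) (auto simp: supp_def)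
      then show ?thesis by (simp add: right_diff_distrib sum_subtractf)
    qed
    then have "(\<Sum>l\<in>T. Sig j l * (\<theta>0 l - \<theta> l)) = lasso_grad n p X ?Y \<theta> j"
      by (simp add: Sigma_hat_apply lasso_grad_def)
    also have "\<dots> = \<xi> * sgn (\<theta> j)"
      using zn j by (intro lasso_stationary n_pos) (auto simp: is_zn_def zn_obj_eq_lasso_obj)
    finally show ?thesis .
  qed
  then have "(\<Sum>k\<in>T. B i k * (\<xi> * sgn (\<theta> k))) = \<theta>0 i - \<theta> i"
    by (intro sub_inv_left[OF finite_T pos_def_Sig _ i]) auto
  then show ?thesis by (simp add: sum_distrib_left mult.left_commute)
qed

end

section \<open>Thresholding at the k-th largest entry\<close>

text \<open>Counting in the decreasing list of moduli. The first \<open>k\<close> positions all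
  reach the selected value, so ties can only enlarge the set in the second claim.\<close>

lemma kth_largest_abs_gt:
  assumes k: "0 < k" "k \<le> card {i. i < p \<and> \<bar>u i\<bar> > t}"
  shows "kth_largest_abs p k u > t"
    and "k \<le> card {i. i < p \<and> \<bar>u i\<bar> \<ge> kth_largest_abs p k u}"
proof -
  define xs where "xs = rev (sort (map (\<lambda>i. \<bar>u i\<bar>) [0..<p]))"
  define m where "m = kth_largest_abs p k u"
  have m: "m = xs ! (k - 1)" by (simp add: m_def kth_largest_abs_def xs_def)
  have sorted: "xs ! j \<le> xs ! i" if "i \<le> j" "j < length xs" for i j
    using that by (auto simp: xs_def rev_nth intro!: sorted_nth_mono)
  have len: "length xs = p" by (simp add: xs_def)
  have "mset xs = mset (map (\<lambda>i. \<bar>u i\<bar>) [0..<p])" by (simp add: xs_def)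
  then have "length (filter P xs) = length (filter P (map (\<lambda>i. \<bar>u i\<bar>) [0..<p]))" for P
    by (metis mset_filter size_mset)
  moreover have "length (filter P (map (\<lambda>i. \<bar>u i\<bar>) [0..<p])) = card {i. i < p \<and> P \<bar>u i\<bar>}" for P
    by (simp add: length_filter_conv_card cong: conj_cong)
  ultimately have count: "card {j. j < length xs \<and> P (xs ! j)} = card {i. i < p \<and> P \<bar>u i\<bar>}" for P
    by (simp add: length_filter_conv_card)
  have "card {i. i < p \<and> \<bar>u i\<bar> > t} \<le> card {..<p}" by (intro card_mono) auto
  then have kp: "k - 1 < length xs" using k len by simp
  show "kth_largest_abs p k u > t"
  proof (rule ccontr)
    assume "\<not> kth_largest_abs p k u > t"
    then have "m \<le> t" by (simp add: m_def)
    \<comment> \<open>Positions start at \<open>0\<close>, so entries above \<open>t\<close> would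
      fit into the \<open>k - 1\<close> positions before the selected one, fewer than the
      \<open>k\<close> assumed.\<close>
    then have "{j. j < length xs \<and> xs ! j > t} \<subseteq> {..<k - 1}"
      using sorted[of "k - 1"] m by (intro subsetI, clarsimp) (meson leD not_less order_trans)
    then have "card {j. j < length xs \<and> xs ! j > t} \<le> k - 1"
      by (metis card_lessThan card_mono finite_lessThan)
    then show False using count[of "\<lambda>x. x > t"] k by simp
  qed
  have "{..<k} \<subseteq> {j. j < length xs \<and> xs ! j \<ge> m}"
    using sorted[of _ "k - 1"] m kp by auto
  then have "k \<le> card {j. j < length xs \<and> xs ! j \<ge> m}"
    using card_mono[of "{j. j < length xs \<and> xs ! j \<ge> m}" "{..<k}"] by simp
  then show "k \<le> card {i. i < p \<and> \<bar>u i\<bar> \<ge> kth_largest_abs p k u}"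
    using count[of "\<lambda>x. x \<ge> m"] by (simp add: m_def)
qed

text \<open>If \<open>t\<close> separates the moduli on \<open>S\<close> from the others, the cutoff
  lies above \<open>t\<close>, so only indices in \<open>S\<close> pass; by the count, all of them
  do.\<close>

lemma S_hat_eq:
  assumes S: "S \<subseteq> {..<p}" and large: "\<And>i. i \<in> S \<Longrightarrow> \<bar>u i\<bar> > t"
    and small: "\<And>i. i < p \<Longrightarrow> i \<notin> S \<Longrightarrow> \<bar>u i\<bar> \<le> t"
  shows "S_hat p (card S) u = S"
proof (cases "card S = 0")
  case True
  then show ?thesis using S finite_subset[OF S] by (simp add: S_hat_def)
next
  case False
  have eq: "{i. i < p \<and> \<bar>u i\<bar> > t} = S"
    using S large small by force
  have k: "0 < card S" "card S \<le> card {i. i < p \<and> \<bar>u i\<bar> > t}" using False eq by simp_all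
  let ?R = "{i. i < p \<and> \<bar>u i\<bar> \<ge> kth_largest_abs p (card S) u}"
  have "?R \<subseteq> S" using kth_largest_abs_gt(1)[OF k] eq by force
  then have "?R = S"
    using kth_largest_abs_gt(2)[OF k] finite_subset[OF S] by (intro card_seteq) auto
  then show ?thesis using False by (simp add: S_hat_def)
qed

text \<open>\<open>lasso\<close> is an arbitrary choice of minimizers, hence possibly not
  measurable. The bounds are therefore given for a measurable set around the bad event and a
  measurable set inside the good one.\<close>

theorem theorem2p6:
  fixes n p :: nat and X :: "nat \<Rightarrow> nat \<Rightarrow> real" and \<theta>0 :: "nat \<Rightarrow> real"
    and \<sigma> C_min \<eta> c1 c2 lam :: real and T0 :: "nat set" and v0 :: "nat \<Rightarrow> real"
    and lasso :: "(nat \<Rightarrow> real) \<Rightarrow> nat \<Rightarrow> real"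
  assumes n_pos: "n > 0" and p_pos: "p > 0" and sigma_pos: "\<sigma> > 0"
    and theta0_supp: "\<forall>j\<ge>p. \<theta>0 j = 0"
    and diag: "\<forall>i<p. Sigma_hat n p X i i \<le> 1"
    \<comment> \<open>T0, v0 as in the context (sign pattern of the ZN estimator for small xi)\<close>
    and v0_vals: "\<forall>i. v0 i \<in> {-1, 0, 1}" and v0_out: "\<forall>i\<ge>p. v0 i = 0"
    and T0_def: "T0 = supp p v0"
    and ZN: "\<exists>\<xi>0>0. \<forall>\<xi>. 0 < \<xi> \<and> \<xi> < \<xi>0 \<longrightarrow>
               (\<exists>\<theta>. is_zn p (Sigma_hat n p X) \<theta>0 \<xi> \<theta> \<and> sgn_vec \<theta> = v0)"
    and T0_S: "supp p \<theta>0 \<subseteq> T0"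
    and v0_S: "\<forall>i\<in>supp p \<theta>0. v0 i = sgn (\<theta>0 i)"
    \<comment> \<open>(i)\<close>
    and Cmin_pos: "C_min > 0"
    and cond_i: "sigma_min_sub (Sigma_hat n p X) T0 \<ge> C_min"
    \<comment> \<open>(ii)\<close>
    and eta_pos: "\<eta> > 0"
    and cond_ii: "\<forall>i<p. i \<notin> T0 \<longrightarrow>
        \<bar>\<Sum>j\<in>T0. Sigma_hat n p X i j * (\<Sum>k\<in>T0. sub_inv (Sigma_hat n p X) T0 j k * v0 k)\<bar> \<le> 1 - \<eta>"
    and c1_gt: "c1 > 1"
    and lambda_def: "lam = (\<sigma> / \<eta>) * sqrt (2 * c1 * ln (real p) / real n)"
    \<comment> \<open>(iii)\<close>
    and c2_pos: "c2 > 0"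
    and cond_iii_S: "\<forall>i\<in>supp p \<theta>0. \<bar>\<theta>0 i\<bar> \<ge> c2 * lam +
        lam * \<bar>\<Sum>k\<in>T0. sub_inv (Sigma_hat n p X) T0 i k * v0 k\<bar>"
    and cond_iii_T0: "\<forall>i\<in>T0 - supp p \<theta>0.
        \<bar>\<Sum>k\<in>T0. sub_inv (Sigma_hat n p X) T0 i k * v0 k\<bar> \<ge> c2"
    and eta_le: "\<eta> \<le> c2 * sqrt C_min"
    \<comment> \<open>lasso W is a Lasso solution for the response Y = X theta0 + W\<close>
    and lasso_min: "\<forall>W\<in>space (noise n \<sigma>).
        is_lasso n p X (\<lambda>i. (\<Sum>j<p. X i j * \<theta>0 j) + W i) lam (lasso W)"
  shows
    "(\<forall>\<mu>>0. \<exists>A\<in>sets (noise n \<sigma>).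
        {W\<in>space (noise n \<sigma>).
           Max ((\<lambda>i. \<bar>gauss_lasso n p X (\<lambda>i. (\<Sum>j<p. X i j * \<theta>0 j) + W i) (lasso W) i
                       - \<theta>0 i\<bar>) ` {..<p}) \<ge> \<mu>} \<subseteq> A \<and>
        measure (noise n \<sigma>) A \<le>
          4 * real p powr (1 - c1) + 2 * real p * exp (- real n * C_min * \<mu>^2 / (2 * \<sigma>^2))) \<and>
     (\<exists>B\<in>sets (noise n \<sigma>).
        B \<subseteq> {W\<in>space (noise n \<sigma>).
          S_hat p (card (supp p \<theta>0))
             (gauss_lasso n p X (\<lambda>i. (\<Sum>j<p. X i j * \<theta>0 j) + W i) (lasso W)) = supp p \<theta>0} \<and>
        measure (noise n \<sigma>) B \<ge> 1 - 6 * real p powr (1 - c1 / 4))"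
proof (cases "p = 1")
  \<comment> \<open>Every power of \<open>p\<close> equals \<open>1\<close> here: the first bound is
    at least \<open>4\<close> and the second is negative, so the whole space and the empty set serve
    as witnesses.\<close>
  case True
  interpret prob_space "noise n \<sigma>" by (rule prob_space_noise[OF sigma_pos])
  have "prob A \<le> 4 * real p powr (1 - c1) + 2 * real p * exp (- real n * C_min * \<mu>^2 / (2 * \<sigma>^2))" for A \<mu>
  proof -
    have "prob A \<le> 4 + 0" by (rule order_trans[OF prob_le_1]) simp
    also have "\<dots> \<le> 4 * real p powr (1 - c1) + 2 * real p * exp (- real n * C_min * \<mu>^2 / (2 * \<sigma>^2))"
      using True by (intro add_mono) auto
    finally show ?thesis .
  qed
  then show ?thesis
    using True by (intro conjI allI impI bexI[of _ "space (noise n \<sigma>)"] bexI[of _ "{}"]) auto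
next
  case False
  interpret prob_space "noise n \<sigma>" by (rule prob_space_noise[OF sigma_pos])
  have p: "real p > 1" using False p_pos by simp
  have lam_pos: "lam > 0"
    unfolding lambda_def using p sigma_pos eta_pos c1_gt n_pos by simp
  have lam_sq: "(lam * \<eta>)\<^sup>2 = 2 * \<sigma>\<^sup>2 * c1 * ln (real p) / real n"
    unfolding lambda_def using p eta_pos c1_gt by (simp add: power_mult_distrib power_divide)
  interpret D: lasso_design n p X T0 C_min
    using n_pos Cmin_pos cond_i by unfold_locales (auto simp: T0_def supp_def)

  \<comment> \<open>Signs of the candidate on the active set\<close>
  define S where "S = supp p \<theta>0"
  define q where "q i = (\<Sum>k\<in>T0. D.B i k * v0 k)" for i
  have \<theta>0_T0: "\<theta>0 j = 0" if "j < p" "j \<notin> T0" for j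
    using that T0_S by (auto simp: supp_def)

  have q_sign: "sgn (q i) = - v0 i" if i: "i \<in> T0 - S" for i
  proof -
    obtain \<xi>0 where "\<xi>0 > 0" and "\<forall>\<xi>. 0 < \<xi> \<and> \<xi> < \<xi>0 \<longrightarrow>
               (\<exists>\<theta>. is_zn p (Sigma_hat n p X) \<theta>0 \<xi> \<theta> \<and> sgn_vec \<theta> = v0)"
      using ZN by blast
    then obtain \<xi> \<theta> where \<xi>: "\<xi> > 0" and zn: "is_zn p D.Sig \<theta>0 \<xi> \<theta>" and "sgn_vec \<theta> = v0"
      using dense[of 0 \<xi>0] by blast
    then have v0: "v0 = (\<lambda>k. sgn (\<theta> k))" by (auto simp: sgn_vec_def)
    have "supp p \<theta> = T0" unfolding T0_def v0 by (simp add: supp_def sgn_0_0)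
    moreover have "\<theta>0 i = 0" using i by (auto simp: S_def T0_def supp_def)
    ultimately have "\<xi> * q i = - \<theta> i"
      using D.zn_error[OF zn _ \<theta>0_T0] i by (simp add: q_def v0)
    then have "sgn (\<xi> * q i) = - sgn (\<theta> i)" by (simp add: sgn_minus)
    then show ?thesis using \<xi> by (simp add: sgn_mult v0)
  qed
  \<comment> \<open>On \<open>S\<close> the entry of \<open>\<theta>0\<close> outweighs noise and
    bias together. Off \<open>S\<close> the bias \<open>- lam * q i\<close> has the sign
    \<open>v0 i\<close> and modulus at least \<open>c2 * lam\<close>, which outweighs the
    noise.\<close>
  have signs: "v0 i \<noteq> 0 \<and> sgn (\<theta>0 i + z - lam * q i) = v0 i"
    if i: "i \<in> T0" and z: "\<bar>z\<bar> < c2 * lam" for i z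
  proof
    show "v0 i \<noteq> 0" using i by (simp add: T0_def supp_def)
    show "sgn (\<theta>0 i + z - lam * q i) = v0 i"
    proof (cases "i \<in> S")
      case True
      have "c2 * lam + \<bar>lam * q i\<bar> \<le> \<bar>\<theta>0 i\<bar>"
        using cond_iii_S True lam_pos by (simp add: S_def q_def abs_mult)
      then have "sgn (\<theta>0 i + z - lam * q i) = sgn (\<theta>0 i)"
        using z by (auto simp: sgn_if)
      then show ?thesis using v0_S True by (simp add: S_def)
    next
      case False
      then have "\<theta>0 i = 0" using i by (auto simp: S_def T0_def supp_def)
      moreover have "c2 * lam \<le> \<bar>lam * q i\<bar>"
        using cond_iii_T0 False i lam_pos by (simp add: S_def q_def abs_mult)
      then have "sgn (z - lam * q i) = - sgn (lam * q i)"
        using z by (auto simp: sgn_if)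
      ultimately show ?thesis
        using q_sign[of i] i False lam_pos by (simp add: sgn_mult)
    qed
  qed

  \<comment> \<open>\<open>E1\<close> is failure of strict dual feasibility and \<open>E2 t\<close>
    a least squares error of size \<open>t\<close> on \<open>T0\<close>; at
    \<open>t = c2 * lam\<close> the latter could spoil a sign.\<close>
  define E1 where "E1 = {W \<in> space (noise n \<sigma>). \<exists>i\<in>{..<p} - T0. lam * \<eta> \<le> \<bar>\<Sum>k<n. D.resid_coeff i k * W k\<bar>}"
  define E2 where "E2 t = {W \<in> space (noise n \<sigma>). \<exists>i\<in>T0. t \<le> \<bar>\<Sum>k<n. D.ls_coeff i k * W k\<bar>}" for t
  define E where "E = E1 \<union> E2 (c2 * lam)"
  define \<theta>GL where "\<theta>GL W = gauss_lasso n p X (\<lambda>i. (\<Sum>j<p. X i j * \<theta>0 j) + W i) (lasso W)" for W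

  have GL: "\<theta>GL W = (\<lambda>i. if i \<in> T0 then \<theta>0 i + D.ls_error W i else 0)"
    if W: "W \<in> space (noise n \<sigma>)" "W \<notin> E" for W
  proof -
    have "supp p (lasso W) = T0"
    proof (rule D.lasso_support[OF lam_pos \<theta>0_T0])
      show "v0 i \<noteq> 0 \<and> sgn (\<theta>0 i + D.ls_error W i - lam * (\<Sum>k\<in>T0. D.B i k * v0 k)) = v0 i"
        if "i \<in> T0" for i
        unfolding q_def[symmetric] using W that
        by (intro signs) (auto simp: E_def E2_def D.ls_error_def not_le)
      show "\<bar>\<Sum>k<n. D.resid_coeff i k * W k\<bar> < lam * \<eta>" if "i < p" "i \<notin> T0" for i
        using W that by (auto simp: E_def E1_def not_le)
      show "\<bar>\<Sum>j\<in>T0. D.Sig i j * (\<Sum>k\<in>T0. D.B j k * v0 k)\<bar> \<le> 1 - \<eta>" if "i < p" "i \<notin> T0" for i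
        using cond_ii that by blast
      show "is_lasso n p X (\<lambda>i. (\<Sum>j<p. X i j * \<theta>0 j) + W i) lam (lasso W)"
        using lasso_min W by blast
    qed
    then show ?thesis
      unfolding \<theta>GL_def by (intro ext D.gauss_lasso_eq \<theta>0_T0)
  qed
  have error: "\<bar>\<theta>GL W i - \<theta>0 i\<bar> < t"
    if W: "W \<in> space (noise n \<sigma>)" "W \<notin> E" "W \<notin> E2 t" and "t > 0" "i < p" for W t i
    using that \<theta>0_T0[of i] by (cases "i \<in> T0") (auto simp: GL[OF W(1,2)] E2_def D.ls_error_def not_le)

  \<comment> \<open>Probabilities of the exceptional events\<close>
  have E1_sets [measurable]: "E1 \<in> sets (noise n \<sigma>)"
    and E1_prob: "prob E1 \<le> real (card ({..<p} - T0)) * (2 * real p powr (- c1))"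
  proof -
    have V: "\<sigma>\<^sup>2 * (\<Sum>k<n. (D.resid_coeff i k)\<^sup>2) \<le> \<sigma>\<^sup>2 / real n" if "i \<in> {..<p} - T0" for i
    proof -
      have "(\<Sum>k<n. (D.resid_coeff i k)\<^sup>2) \<le> D.Sig i i / real n" by (rule D.resid_coeff_norm)
      also have "\<dots> \<le> 1 / real n" using diag that by (intro divide_right_mono) auto
      finally show ?thesis using mult_left_mono[of _ "1 / real n" "\<sigma>\<^sup>2"] by simp
    qed
    note tail = noise_union_tail[where a = D.resid_coeff, OF sigma_pos _ _ _ V, of "lam * \<eta>" "{..<p} - T0"]
    show "E1 \<in> sets (noise n \<sigma>)"
      unfolding E1_def using lam_pos eta_pos sigma_pos n_pos by (intro tail(1)) auto
    have "- (lam * \<eta>)\<^sup>2 / (2 * (\<sigma>\<^sup>2 / real n)) = - c1 * ln (real p)"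
      unfolding lam_sq using sigma_pos n_pos by simp
    then have "exp (- (lam * \<eta>)\<^sup>2 / (2 * (\<sigma>\<^sup>2 / real n))) = real p powr (- c1)"
      using p by (simp add: powr_def)
    then show "prob E1 \<le> real (card ({..<p} - T0)) * (2 * real p powr (- c1))"
      using tail(2) lam_pos eta_pos sigma_pos n_pos by (simp add: E1_def)
  qed

  have E2_sets [measurable]: "E2 t \<in> sets (noise n \<sigma>)"
    and E2_prob: "prob (E2 t) \<le> real (card T0) * (2 * exp (- real n * C_min * t\<^sup>2 / (2 * \<sigma>\<^sup>2)))"
    if "t > 0" for t
  proof -
    have V: "\<sigma>\<^sup>2 * (\<Sum>k<n. (D.ls_coeff i k)\<^sup>2) \<le> \<sigma>\<^sup>2 / (real n * C_min)" if "i \<in> T0" for i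
      using mult_left_mono[OF D.ls_coeff_norm[OF that], of "\<sigma>\<^sup>2"] by simp
    have V_pos: "\<sigma>\<^sup>2 / (real n * C_min) > 0" using sigma_pos n_pos Cmin_pos by simp
    note tail = noise_union_tail[where a = D.ls_coeff, OF sigma_pos \<open>t > 0\<close> V_pos D.finite_T V]
    show "E2 t \<in> sets (noise n \<sigma>)" unfolding E2_def by (rule tail(1))
    have "- t\<^sup>2 / (2 * (\<sigma>\<^sup>2 / (real n * C_min))) = - real n * C_min * t\<^sup>2 / (2 * \<sigma>\<^sup>2)"
      using sigma_pos n_pos Cmin_pos by (simp add: field_simps)
    then show "prob (E2 t) \<le> real (card T0) * (2 * exp (- real n * C_min * t\<^sup>2 / (2 * \<sigma>\<^sup>2)))"
      using tail(2) unfolding E2_def by metis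
  qed
  \<comment> \<open>Since \<open>\<eta>\<^sup>2 \<le> c2\<^sup>2 * C_min\<close>, the choice of
    \<open>lam\<close> turns the exponent into a multiple of \<open>ln p\<close>. It is used with
    \<open>a = 1\<close> for sign recovery and \<open>a = 1 / 2\<close> for thresholding.\<close>
  have exp_le: "exp (- real n * C_min * (a * (c2 * lam))\<^sup>2 / (2 * \<sigma>\<^sup>2)) \<le> real p powr (- c1 * a\<^sup>2)" for a
  proof -
    have "\<eta>\<^sup>2 \<le> c2\<^sup>2 * C_min"
      using power_mono[OF eta_le, of 2] eta_pos Cmin_pos by (simp add: power_mult_distrib)
    then have "(real n * a\<^sup>2 * lam\<^sup>2 / (2 * \<sigma>\<^sup>2)) * \<eta>\<^sup>2 \<le> (real n * a\<^sup>2 * lam\<^sup>2 / (2 * \<sigma>\<^sup>2)) * (c2\<^sup>2 * C_min)"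
      by (intro mult_left_mono) auto
    moreover have "(real n * a\<^sup>2 * lam\<^sup>2 / (2 * \<sigma>\<^sup>2)) * \<eta>\<^sup>2 = a\<^sup>2 * real n * (lam * \<eta>)\<^sup>2 / (2 * \<sigma>\<^sup>2)"
      by (simp add: power_mult_distrib)
    moreover have "\<dots> = c1 * a\<^sup>2 * ln (real p)"
      unfolding lam_sq using sigma_pos n_pos by simp
    ultimately have "- real n * C_min * (a * (c2 * lam))\<^sup>2 / (2 * \<sigma>\<^sup>2) \<le> - c1 * a\<^sup>2 * ln (real p)"
      by (simp add: power_mult_distrib ac_simps)
    then show ?thesis using p by (simp add: powr_def)
  qed
  have card_T0: "card T0 \<le> p"
    using card_mono[OF _ D.T_sub] by simp
  have p_powr: "real p * real p powr (- c) = real p powr (1 - c)" for c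
    using p by (simp add: powr_diff powr_minus divide_inverse)
  have E_sets [measurable]: "E \<in> sets (noise n \<sigma>)"
    unfolding E_def using E2_sets c2_pos lam_pos by simp
  \<comment> \<open>The union bounds run over the complementary sets \<open>T0\<close> and
    \<open>{..<p} - T0\<close>, so together they cost one factor \<open>p\<close>.\<close>
  have E_prob: "prob E \<le> 2 * real p powr (1 - c1)"
  proof -
    have "prob E \<le> prob E1 + prob (E2 (c2 * lam))"
      unfolding E_def using E2_sets c2_pos lam_pos by (intro measure_Un_le) auto
    also have "\<dots> \<le> real (card ({..<p} - T0)) * (2 * real p powr (- c1)) + real (card T0) * (2 * real p powr (- c1))"
      using exp_le[of 1] c2_pos lam_pos
      by (intro add_mono E1_prob order_trans[OF E2_prob] mult_left_mono) auto
    also have "\<dots> = real (card ({..<p} - T0) + card T0) * (2 * real p powr (- c1))"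
      by (simp add: distrib_right)
    also have "card ({..<p} - T0) + card T0 = p"
      using card_Diff_subset[OF D.finite_T D.T_sub] card_T0 by simp
    finally show ?thesis by (simp add: p_powr[symmetric])
  qed
  have EE2_prob: "prob (E \<union> E2 t) \<le> 2 * real p powr (1 - c1) + 2 * real p * exp (- real n * C_min * t\<^sup>2 / (2 * \<sigma>\<^sup>2))"
    if "t > 0" for t
  proof -
    have "prob (E \<union> E2 t) \<le> prob E + prob (E2 t)"
      using E2_sets[OF that] by (intro measure_Un_le) auto
    moreover have "real (card T0) * (2 * exp (- real n * C_min * t\<^sup>2 / (2 * \<sigma>\<^sup>2)))
        \<le> real p * (2 * exp (- real n * C_min * t\<^sup>2 / (2 * \<sigma>\<^sup>2)))"
      using card_T0 by (intro mult_right_mono) auto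
    ultimately show ?thesis using E_prob E2_prob[OF that] by linarith
  qed

  \<comment> \<open>Estimation error and model selection outside the exceptional events\<close>
  have part1: "\<exists>A\<in>sets (noise n \<sigma>).
      {W \<in> space (noise n \<sigma>). Max ((\<lambda>i. \<bar>\<theta>GL W i - \<theta>0 i\<bar>) ` {..<p}) \<ge> \<mu>} \<subseteq> A \<and>
      prob A \<le> 4 * real p powr (1 - c1) + 2 * real p * exp (- real n * C_min * \<mu>\<^sup>2 / (2 * \<sigma>\<^sup>2))"
    if \<mu>: "\<mu> > 0" for \<mu>
  proof (intro bexI conjI subsetI)
    show "E \<union> E2 \<mu> \<in> sets (noise n \<sigma>)" using E2_sets[OF \<mu>] by simp
    have "2 * real p powr (1 - c1) \<le> 4 * real p powr (1 - c1)" by simp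
    then show "prob (E \<union> E2 \<mu>) \<le> 4 * real p powr (1 - c1) + 2 * real p * exp (- real n * C_min * \<mu>\<^sup>2 / (2 * \<sigma>\<^sup>2))"
      using EE2_prob[OF \<mu>] by linarith
    fix W assume W: "W \<in> {W \<in> space (noise n \<sigma>). Max ((\<lambda>i. \<bar>\<theta>GL W i - \<theta>0 i\<bar>) ` {..<p}) \<ge> \<mu>}"
    then have "\<exists>i<p. \<mu> \<le> \<bar>\<theta>GL W i - \<theta>0 i\<bar>"
      using p_pos by (subst (asm) mem_Collect_eq, subst (asm) Max_ge_iff) auto
    then show "W \<in> E \<union> E2 \<mu>"
      using error[of W \<mu>] W \<mu> by force
  qed

  have part2: "\<exists>B\<in>sets (noise n \<sigma>).
      B \<subseteq> {W \<in> space (noise n \<sigma>). S_hat p (card S) (\<theta>GL W) = S} \<and>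
      prob B \<ge> 1 - 6 * real p powr (1 - c1 / 4)"
  proof (intro bexI conjI subsetI)
    \<comment> \<open>Half the minimal signal: an error below it keeps entries on \<open>S\<close>
      above the threshold and the others below. Squaring the factor \<open>1 / 2\<close> yields the
      exponent \<open>c1 / 4\<close>.\<close>
    let ?t = "1 / 2 * (c2 * lam)"
    have t: "?t > 0" using c2_pos lam_pos by simp
    let ?F = "E \<union> E2 ?t"
    have F: "?F \<in> sets (noise n \<sigma>)" using E2_sets[OF t] by simp
    then show "space (noise n \<sigma>) - ?F \<in> sets (noise n \<sigma>)" by auto
    have "real p * exp (- real n * C_min * ?t\<^sup>2 / (2 * \<sigma>\<^sup>2)) \<le> real p * real p powr (- (c1 / 4))"
      using exp_le[of "1 / 2"] by (intro mult_left_mono) (auto simp: power_divide)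
    then have "real p * exp (- real n * C_min * ?t\<^sup>2 / (2 * \<sigma>\<^sup>2)) \<le> real p powr (1 - c1 / 4)"
      by (simp only: p_powr)
    moreover have "real p powr (1 - c1) \<le> real p powr (1 - c1 / 4)"
      using p c1_gt by (intro powr_mono) auto
    moreover have "0 \<le> real p powr (1 - c1 / 4)" by simp
    ultimately have "prob ?F \<le> 6 * real p powr (1 - c1 / 4)"
      using EE2_prob[OF t] by linarith
    then show "1 - 6 * real p powr (1 - c1 / 4) \<le> prob (space (noise n \<sigma>) - ?F)"
      using prob_compl[OF F] by simp
    fix W assume W: "W \<in> space (noise n \<sigma>) - ?F"
    have err: "\<bar>\<theta>GL W i - \<theta>0 i\<bar> < ?t" if "i < p" for i
      using error[of W ?t i] W t that by simp
    have "S_hat p (card S) (\<theta>GL W) = S"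
    proof (rule S_hat_eq)
      show "S \<subseteq> {..<p}" by (auto simp: S_def supp_def)
      show "\<bar>\<theta>GL W i\<bar> > ?t" if "i \<in> S" for i
      proof -
        have "0 \<le> lam * \<bar>q i\<bar>" using lam_pos by simp
        then have "c2 * lam \<le> \<bar>\<theta>0 i\<bar>"
          using cond_iii_S that by (fastforce simp: S_def q_def)
        moreover have "i < p" using that by (simp add: S_def supp_def)
        ultimately show ?thesis using err[of i] by linarith
      qed
      show "\<bar>\<theta>GL W i\<bar> \<le> ?t" if "i < p" "i \<notin> S" for i
        using err[of i] that by (simp add: S_def supp_def)
    qed
    then show "W \<in> {W \<in> space (noise n \<sigma>). S_hat p (card S) (\<theta>GL W) = S}" using W by simp
  qed
  show ?thesis
    using part1 part2 unfolding \<theta>GL_def S_def by blast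
qed

end
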